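(* Let $m\ge1$ be an integer and let $T$ be an $m\times m$ matrix with integer entries and $\det T\ne0$. If the group $G(m,T)$ has exponential growth, then for every finite generating set $Y$ of $G(m,T)$, the subgroup $A(m,T)$ is exponentially negligible in $G(m,T)$ with respect to $Y$.
   Context: For $m\ge 1$ and an $m\times m$ integer matrix $T$ with $\det T\neq0$, the group $G(m,T)$ is given by the presentation with generators $a_1,\ldots,a_m,t$ and relations $a_ia_j=a_ja_i$ for $1\le i<j\le m$ and $t\mathbf{a}^{\mathbf{u}}t^{-1}=\mathbf{a}^{T\mathbf{u}}$ for all $\mathbf{u}\in\mathbb{Z}^m$, where $\mathbf{a}^{\mathbf{v}}=a_1^{v_1}\cdots a_m^{v_m}$ for $\mathbf{v}=(v_1,\ldots,v_m)\in\mathbb{Z}^m$. Let $\tau:G(m,T)\to\mathbb{Z}$ be the homomorphism with $\tau(a_i)=0$ for all $i$ and $\tau(t)=1$. The elliptic subgroup is $A(m,T)=\ker\tau$. For a finite generating set $Y$ of a group $G$, let $|g|_Y$ be the minimal length of a word in the elements of $Y$ and their inverses representing $g\in G$, and for $n \in \mathbb{Z}_{\ge 0}$ let $B_Y(n)=\{g\in G \mid |g|_Y\le n\}$. The group $G$ has exponential growth if $\liminf_{n\to\infty}\sqrt[n]{|B_Y(n)|}>1$ for some (equivalently, every) finite generating set $Y$. A subset $\mathcal{A}\subseteq G$ is exponentially negligible in $G$ with respect to $Y$ if $$\limsup_{n\to\infty}\sqrt[n]{\frac{|\mathcal{A}\cap B_Y(n)|}{|B_Y(n)|}}<1.$$ 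*)

theory Defs
  imports
    Complex_Main
    "HOL-Library.Extended_Real"
    "HOL-Library.Liminf_Limsup"
    "HOL-Algebra.Elementary_Groups"
    "HOL-Algebra.Generated_Groups"
    "Jordan_Normal_Form.Determinant"
begin

section \<open>Group presentations\<close>

text \<open>A word over the generators; the letter \<open>(x, True)\<close> stands for \<open>x\<close> and
  \<open>(x, False)\<close> for its inverse.\<close>

type_synonym 'g gword = "('g \<times> bool) list"

definition gwords :: "'g set \<Rightarrow> 'g gword set"
  where "gwords S = lists (S \<times> UNIV)"

text \<open>Equality of words in the group with generators \<open>S\<close> and relations \<open>u = v\<close> for
  \<open>(u, v) \<in> R\<close>: the least congruence on words that contains the relations and free cancellation.\<close>

inductive pres_eq :: "'g set \<Rightarrow> ('g gword \<times> 'g gword) set \<Rightarrow> 'g gword \<Rightarrow> 'g gword \<Rightarrow> bool"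
  for S R
where
  refl: "w \<in> gwords S \<Longrightarrow> pres_eq S R w w"
| sym: "pres_eq S R u v \<Longrightarrow> pres_eq S R v u"
| trans: "pres_eq S R u v \<Longrightarrow> pres_eq S R v w \<Longrightarrow> pres_eq S R u w"
| app: "pres_eq S R u v \<Longrightarrow> pres_eq S R u' v' \<Longrightarrow> pres_eq S R (u @ u') (v @ v')"
| cancel: "x \<in> S \<Longrightarrow> pres_eq S R [(x, e), (x, \<not> e)] []"
| rel: "(u, v) \<in> R \<Longrightarrow> u \<in> gwords S \<Longrightarrow> v \<in> gwords S \<Longrightarrow> pres_eq S R u v"

definition pres_class :: "'g set \<Rightarrow> ('g gword \<times> 'g gword) set \<Rightarrow> 'g gword \<Rightarrow> 'g gword set"
  where "pres_class S R w = {v. pres_eq S R w v}"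

definition presented_group ::
    "'g set \<Rightarrow> ('g gword \<times> 'g gword) set \<Rightarrow> 'g gword set monoid"
  where "presented_group S R =
    \<lparr>carrier = pres_class S R ` gwords S,
     monoid.mult = (\<lambda>X Y. \<Union>x\<in>X. \<Union>y\<in>Y. pres_class S R (x @ y)),
     one = pres_class S R []\<rparr>"

definition pres_gen :: "'g set \<Rightarrow> ('g gword \<times> 'g gword) set \<Rightarrow> 'g \<Rightarrow> 'g gword set"
  where "pres_gen S R x = pres_class S R [(x, True)]"

lemma gwords_simps [simp]:
  "[] \<in> gwords S"
  "l # w \<in> gwords S \<longleftrightarrow> fst l \<in> S \<and> w \<in> gwords S"
  "u @ v \<in> gwords S \<longleftrightarrow> u \<in> gwords S \<and> v \<in> gwords S"
  by (cases l; auto simp: gwords_def)+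

lemma pres_eq_gwords: "pres_eq S R u v \<Longrightarrow> u \<in> gwords S \<and> v \<in> gwords S"
  by (induction rule: pres_eq.induct) auto

lemma pres_class_eq_iff:
  assumes "u \<in> gwords S"
  shows "pres_class S R u = pres_class S R v \<longleftrightarrow> pres_eq S R u v"
proof
  assume "pres_class S R u = pres_class S R v"
  then have "u \<in> pres_class S R v"
    using pres_eq.refl[OF assms] by (auto simp: pres_class_def)
  then show "pres_eq S R u v"
    by (auto simp: pres_class_def intro: pres_eq.sym)
next
  assume "pres_eq S R u v"
  then show "pres_class S R u = pres_class S R v"
    unfolding pres_class_def using pres_eq.sym pres_eq.trans by blast
qed

lemma carrier_presented_group: "carrier (presented_group S R) = pres_class S R ` gwords S"
  by (simp add: presented_group_def)

lemma one_presented_group: "\<one>\<^bsub>presented_group S R\<^esub> = pres_class S R []"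
  by (simp add: presented_group_def)

lemma mult_presented_group:
  assumes "u \<in> gwords S" "v \<in> gwords S"
  shows "pres_class S R u \<otimes>\<^bsub>presented_group S R\<^esub> pres_class S R v = pres_class S R (u @ v)"
proof -
  have *: "pres_class S R (x @ y) = pres_class S R (u @ v)"
    if "x \<in> pres_class S R u" "y \<in> pres_class S R v" for x y
  proof -
    have "pres_eq S R (u @ v) (x @ y)"
      using that by (auto simp: pres_class_def intro: pres_eq.app)
    then show ?thesis
      using pres_class_eq_iff[of "u @ v" S R "x @ y"] assms by simp
  qed
  have "u \<in> pres_class S R u" "v \<in> pres_class S R v"
    using assms by (auto simp: pres_class_def intro: pres_eq.refl)
  then have "(\<Union>x\<in>pres_class S R u. \<Union>y\<in>pres_class S R v. pres_class S R (x @ y)) =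
      pres_class S R (u @ v)"
    using * by blast
  then show ?thesis
    by (simp add: presented_group_def)
qed

definition inv_gword :: "'g gword \<Rightarrow> 'g gword"
  where "inv_gword w = rev (map (\<lambda>(x, e). (x, \<not> e)) w)"

lemma inv_gword_gwords: "w \<in> gwords S \<Longrightarrow> inv_gword w \<in> gwords S"
  by (induction w) (auto simp: inv_gword_def)

lemma inv_gword_cancel: "w \<in> gwords S \<Longrightarrow> pres_eq S R (inv_gword w @ w) []"
proof (induction w)
  case Nil
  show ?case by (auto simp: inv_gword_def intro: pres_eq.refl)
next
  case (Cons l w)
  obtain x e where l: "l = (x, e)" by (cases l)
  have x: "x \<in> S" and w: "w \<in> gwords S" using Cons.prems l by auto
  have c: "pres_eq S R [(x, \<not> e), (x, e)] []"
    using pres_eq.cancel[OF x, of R "\<not> e"] by simp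
  have "pres_eq S R (inv_gword w @ ([(x, \<not> e), (x, e)] @ w)) (inv_gword w @ ([] @ w))"
    by (intro pres_eq.app c pres_eq.refl w inv_gword_gwords)
  then have "pres_eq S R (inv_gword (l # w) @ l # w) (inv_gword w @ w)"
    by (simp add: inv_gword_def l)
  with Cons.IH[OF w] show ?case by (rule pres_eq.trans[rotated])
qed

lemma group_presented_group: "Group.group (presented_group S R)"
proof (rule groupI)
  fix x assume "x \<in> carrier (presented_group S R)"
  then obtain u where u: "u \<in> gwords S" "x = pres_class S R u"
    by (auto simp: carrier_presented_group)
  have "pres_class S R (inv_gword u @ u) = pres_class S R []"
    using pres_class_eq_iff[of "inv_gword u @ u" S R "[]"] inv_gword_cancel[OF u(1)]
      inv_gword_gwords[OF u(1)] u(1) by simp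
  then show "\<exists>y\<in>carrier (presented_group S R).
      y \<otimes>\<^bsub>presented_group S R\<^esub> x = \<one>\<^bsub>presented_group S R\<^esub>"
    using u inv_gword_gwords[of u S]
    by (auto simp: carrier_presented_group mult_presented_group one_presented_group)
qed (auto simp: carrier_presented_group mult_presented_group one_presented_group)

definition eval_gword :: "('a, 'b) monoid_scheme \<Rightarrow> ('g \<Rightarrow> 'a) \<Rightarrow> 'g gword \<Rightarrow> 'a"
  where "eval_gword H f w =
    foldr (\<lambda>l y. (if snd l then f (fst l) else inv\<^bsub>H\<^esub> f (fst l)) \<otimes>\<^bsub>H\<^esub> y) w \<one>\<^bsub>H\<^esub>"

lemma (in group) eval_gword_closed:
  assumes "f ` S \<subseteq> carrier G" "w \<in> gwords S"
  shows "eval_gword G f w \<in> carrier G"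
  using assms(2) by (induction w) (use assms(1) in \<open>auto simp: eval_gword_def\<close>)

lemma (in group) eval_gword_append:
  assumes "f ` S \<subseteq> carrier G" "u \<in> gwords S" "v \<in> gwords S"
  shows "eval_gword G f (u @ v) = eval_gword G f u \<otimes> eval_gword G f v"
  using assms(2)
proof (induction u)
  case Nil
  then show ?case using eval_gword_closed[OF assms(1,3)] by (simp add: eval_gword_def)
next
  case (Cons l u)
  let ?l = "if snd l then f (fst l) else inv f (fst l)"
  have "?l \<in> carrier G" using Cons.prems assms(1) by auto
  moreover have "eval_gword G f (l # w) = ?l \<otimes> eval_gword G f w" for w
    by (simp add: eval_gword_def)
  ultimately show ?case
    using Cons eval_gword_closed[OF assms(1)] assms(3) by (simp add: m_assoc)
qed

lemma (in group) eval_gword_pres_eq: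
  assumes f: "f ` S \<subseteq> carrier G"
    and R: "\<And>u v. (u, v) \<in> R \<Longrightarrow> eval_gword G f u = eval_gword G f v"
    and "pres_eq S R u v"
  shows "eval_gword G f u = eval_gword G f v"
  using assms(3)
proof (induction rule: pres_eq.induct)
  case (app u v u' v')
  then show ?case
    using eval_gword_append[OF f] pres_eq_gwords by metis
next
  case (cancel x e)
  then have "f x \<in> carrier G" using f by auto
  then show ?case by (auto simp: eval_gword_def)
qed (auto intro: R)

text \<open>The universal property of a presentation (von Dyck).\<close>

lemma presented_group_universal:
  assumes H: "Group.group H" and f: "f ` S \<subseteq> carrier H"
    and R: "\<And>u v. (u, v) \<in> R \<Longrightarrow> eval_gword H f u = eval_gword H f v"
  shows "\<exists>h. h \<in> hom (presented_group S R) H \<and> (\<forall>x\<in>S. h (pres_gen S R x) = f x)"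
proof -
  interpret H: Group.group H by (fact H)
  define h where "h X = eval_gword H f (SOME w. w \<in> X)" for X
  have h: "h (pres_class S R w) = eval_gword H f w" if "w \<in> gwords S" for w
  proof -
    have "w \<in> pres_class S R w" using that by (auto simp: pres_class_def intro: pres_eq.refl)
    then have "(SOME v. v \<in> pres_class S R w) \<in> pres_class S R w" by (rule someI)
    then have "pres_eq S R w (SOME v. v \<in> pres_class S R w)" by (simp add: pres_class_def)
    from H.eval_gword_pres_eq[OF f R this] show ?thesis by (simp add: h_def)
  qed
  have "h \<in> hom (presented_group S R) H"
    by (rule homI)
      (auto simp: carrier_presented_group mult_presented_group h H.eval_gword_append[OF f]
          H.eval_gword_closed[OF f])
  moreover have "h (pres_gen S R x) = f x" if "x \<in> S" for x
  proof -
    have "f x \<in> carrier H" using f that by auto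
    then show ?thesis using that by (simp add: pres_gen_def h eval_gword_def)
  qed
  ultimately show ?thesis by blast
qed

lemma presented_group_hom_unique:
  assumes H: "Group.group H"
    and h: "h \<in> hom (presented_group S R) H" and k: "k \<in> hom (presented_group S R) H"
    and eq: "\<And>x. x \<in> S \<Longrightarrow> h (pres_gen S R x) = k (pres_gen S R x)"
    and X: "X \<in> carrier (presented_group S R)"
  shows "h X = k X"
proof -
  let ?P = "presented_group S R"
  interpret P: Group.group ?P by (rule group_presented_group)
  interpret h: group_hom ?P H h
    by (simp add: group_hom_def group_hom_axioms_def H h P.is_group)
  interpret k: group_hom ?P H k
    by (simp add: group_hom_def group_hom_axioms_def H k P.is_group)
  have "h (pres_class S R w) = k (pres_class S R w)" if "w \<in> gwords S" for w
    using that
  proof (induction w)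
    case Nil
    show ?case using h.hom_one k.hom_one by (simp add: one_presented_group)
  next
    case (Cons l w)
    obtain x e where l: "l = (x, e)" by (cases l)
    have x: "x \<in> S" and w: "w \<in> gwords S" using Cons.prems l by auto
    have g: "pres_gen S R x \<in> carrier ?P"
      using x by (auto simp: pres_gen_def carrier_presented_group)
    have lc: "pres_class S R [l] \<in> carrier ?P" and wc: "pres_class S R w \<in> carrier ?P"
      using x w l by (auto simp: carrier_presented_group)
    have "h (pres_class S R [l]) = k (pres_class S R [l])"
    proof (cases e)
      case True
      then show ?thesis using eq[OF x] l by (simp add: pres_gen_def)
    next
      case False
      have "pres_class S R [(x, False), (x, True)] = pres_class S R []"
        using pres_class_eq_iff[of "[(x, False), (x, True)]" S R "[]"]
          pres_eq.cancel[OF x, of R False] x by simp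
      then have "pres_class S R [l] \<otimes>\<^bsub>?P\<^esub> pres_gen S R x = \<one>\<^bsub>?P\<^esub>"
        using x l False by (simp add: pres_gen_def mult_presented_group one_presented_group)
      then have "pres_class S R [l] = inv\<^bsub>?P\<^esub> pres_gen S R x"
        using P.inv_equality[OF _ g lc] by simp
      then show ?thesis using eq[OF x] g by simp
    qed
    moreover have "pres_class S R (l # w) = pres_class S R [l] \<otimes>\<^bsub>?P\<^esub> pres_class S R w"
      using x w l by (simp add: mult_presented_group)
    ultimately show ?case
      using Cons.IH[OF w] h.hom_mult[OF lc wc] k.hom_mult[OF lc wc] by simp
  qed
  then show ?thesis using X by (auto simp: carrier_presented_group)
qed

section \<open>The groups \<open>G(m,T)\<close>\<close>

text \<open>Vectors and matrices are indexed from \<open>0\<close>, so the commuting generators are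
  \<open>GenA 0, \<dots>, GenA (m - 1)\<close>.\<close>

datatype gen = GenA nat | GenT

definition gens :: "nat \<Rightarrow> gen set"
  where "gens m = insert GenT (GenA ` {..<m})"

definition pow_word :: "'g \<Rightarrow> int \<Rightarrow> 'g gword"
  where "pow_word x k = replicate (nat \<bar>k\<bar>) (x, 0 \<le> k)"

definition vec_word :: "nat \<Rightarrow> int vec \<Rightarrow> gen gword"
  where "vec_word m v = concat (map (\<lambda>i. pow_word (GenA i) (v $ i)) [0..<m])"

definition rels :: "nat \<Rightarrow> int mat \<Rightarrow> (gen gword \<times> gen gword) set"
  where "rels m T =
    {([(GenA i, True), (GenA j, True)], [(GenA j, True), (GenA i, True)]) | i j. i < j \<and> j < m} \<union>
    {([(GenT, True)] @ vec_word m u @ [(GenT, False)], vec_word m (T *\<^sub>v u)) | u. u \<in> carrier_vec m}"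

definition GmT :: "nat \<Rightarrow> int mat \<Rightarrow> gen gword set monoid"
  where "GmT m T = presented_group (gens m) (rels m T)"

definition gen_a :: "nat \<Rightarrow> int mat \<Rightarrow> nat \<Rightarrow> gen gword set"
  where "gen_a m T i = pres_gen (gens m) (rels m T) (GenA i)"

definition gen_t :: "nat \<Rightarrow> int mat \<Rightarrow> gen gword set"
  where "gen_t m T = pres_gen (gens m) (rels m T) GenT"

text \<open>\<open>\<tau>\<close> is determined only on the carrier; existence and uniqueness there are
  \<open>tau_hom\<close> and \<open>tau_unique\<close> below.\<close>

definition tau :: "nat \<Rightarrow> int mat \<Rightarrow> gen gword set \<Rightarrow> int"
  where "tau m T = (SOME f. f \<in> hom (GmT m T) integer_group \<and>
    (\<forall>i<m. f (gen_a m T i) = 0) \<and> f (gen_t m T) = 1)"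

definition elliptic_subgroup :: "nat \<Rightarrow> int mat \<Rightarrow> gen gword set set"
  where "elliptic_subgroup m T = kernel (GmT m T) integer_group (tau m T)"

lemma group_GmT: "Group.group (GmT m T)"
  by (simp add: GmT_def group_presented_group)

lemma vec_word_gwords: "vec_word m v \<in> gwords (gens m)"
  by (auto simp: vec_word_def gwords_def pow_word_def gens_def)

lemma rels_gwords: "rels m T \<subseteq> gwords (gens m) \<times> gwords (gens m)"
  by (auto simp: rels_def vec_word_gwords) (auto simp: gens_def)

lemma tau_hom:
  "tau m T \<in> hom (GmT m T) integer_group \<and>
   (\<forall>i<m. tau m T (gen_a m T i) = 0) \<and> tau m T (gen_t m T) = 1"
proof -
  define f :: "gen \<Rightarrow> int" where "f x = (if x = GenT then 1 else 0)" for x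
  let ?ev = "eval_gword integer_group f"
  interpret Z: Group.group integer_group by simp
  have f: "f ` gens m \<subseteq> carrier integer_group" by (simp add: integer_group_def)
  have pow: "?ev (replicate k (GenA i, e) @ w) = ?ev w" for k i e w
    by (induction k) (auto simp: eval_gword_def f_def)
  have vec: "?ev (concat (map (\<lambda>i. pow_word (GenA i) (g i)) xs) @ w) = ?ev w" for g xs w
    by (induction xs) (auto simp: pow_word_def pow)
  have vec: "?ev (vec_word m v @ w) = ?ev w" for v w
    by (simp add: vec_word_def vec)
  have ev: "?ev [] = 0" "?ev (l # w) = (if snd l then f (fst l) else - f (fst l)) + ?ev w" for l w
    by (simp_all add: eval_gword_def)
  have "?ev u = ?ev v" if "(u, v) \<in> rels m T" for u v
    using that vec[where w = "[]"] by (auto simp: rels_def ev vec f_def)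
  from presented_group_universal[OF Z.is_group f, of "rels m T", OF this]
  obtain h where h: "h \<in> hom (GmT m T) integer_group"
      "\<And>x. x \<in> gens m \<Longrightarrow> h (pres_gen (gens m) (rels m T) x) = f x"
    by (auto simp: GmT_def)
  then have "\<exists>h. h \<in> hom (GmT m T) integer_group \<and>
      (\<forall>i<m. h (gen_a m T i) = 0) \<and> h (gen_t m T) = 1"
    by (intro exI[of _ h]) (auto simp: gens_def gen_a_def gen_t_def f_def)
  from someI_ex[OF this] show ?thesis unfolding tau_def .
qed

lemma tau_unique:
  assumes "f \<in> hom (GmT m T) integer_group" "\<forall>i<m. f (gen_a m T i) = 0" "f (gen_t m T) = 1"
    and "g \<in> carrier (GmT m T)"
  shows "f g = tau m T g"
proof (rule presented_group_hom_unique[of integer_group])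
  show "f \<in> hom (presented_group (gens m) (rels m T)) integer_group"
    "tau m T \<in> hom (presented_group (gens m) (rels m T)) integer_group"
    "g \<in> carrier (presented_group (gens m) (rels m T))"
    using assms tau_hom[of m T] by (auto simp: GmT_def)
  show "f (pres_gen (gens m) (rels m T) x) = tau m T (pres_gen (gens m) (rels m T) x)"
    if "x \<in> gens m" for x
    using that assms tau_hom[of m T] by (auto simp: gens_def gen_a_def gen_t_def)
qed simp

section \<open>Growth and negligible sets\<close>

definition finite_generating_set :: "('a, 'b) monoid_scheme \<Rightarrow> 'a set \<Rightarrow> bool"
  where "finite_generating_set G Y \<longleftrightarrow>
    finite Y \<and> Y \<subseteq> carrier G \<and> generate G Y = carrier G"

definition word_length :: "('a, 'b) monoid_scheme \<Rightarrow> 'a set \<Rightarrow> 'a \<Rightarrow> nat"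
  where "word_length G Y g =
    (LEAST n. \<exists>ws. length ws = n \<and> set ws \<subseteq> Y \<union> m_inv G ` Y \<and> foldr (\<otimes>\<^bsub>G\<^esub>) ws \<one>\<^bsub>G\<^esub> = g)"

definition word_ball :: "('a, 'b) monoid_scheme \<Rightarrow> 'a set \<Rightarrow> nat \<Rightarrow> 'a set"
  where "word_ball G Y n = {g \<in> carrier G. word_length G Y g \<le> n}"

definition exponential_growth :: "('a, 'b) monoid_scheme \<Rightarrow> bool"
  where "exponential_growth G \<longleftrightarrow>
    (\<exists>Y. finite_generating_set G Y \<and>
      liminf (\<lambda>n. ereal (root n (real (card (word_ball G Y n))))) > 1)"

definition exponentially_negligible :: "('a, 'b) monoid_scheme \<Rightarrow> 'a set \<Rightarrow> 'a set \<Rightarrow> bool"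
  where "exponentially_negligible G Y A \<longleftrightarrow>
    A \<subseteq> carrier G \<and>
    limsup (\<lambda>n. ereal (root n
      (real (card (A \<inter> word_ball G Y n)) / real (card (word_ball G Y n))))) < 1"

end

theory Submission
  imports Defs "HOL-Algebra.Divisibility" "Jordan_Normal_Form.Spectral_Radius"
begin

text \<open>
  Let \<open>A\<close> be the kernel of \<open>\<tau>\<close>. It is abelian, and a group element acts on it by conjugation only
  through its height \<open>\<tau> g\<close>. A word in the generators \<open>Y\<close> is read as a path of heights, with steps
  of bounded size; for an element of \<open>A\<close> the path is closed. Let \<open>B(n)\<close> be the balls with respect to
  \<open>Y\<close> and \<open>\<omega> = inf |B(n)|^(1/n)\<close>, so that \<open>|B(n)|\<close> lies between \<open>\<omega>^n\<close> and \<open>C \<beta>^n\<close> for each \<open>\<beta> > \<omega>\<close>.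
  The elements of \<open>A \<inter> B(n)\<close> are split according to whether a geodesic word reaches a height of
  absolute value above a small multiple of \<open>n\<close>.

  Low paths are few (\<open>card_low_elements_le\<close>). Because \<open>A\<close> is abelian, such an element depends only
  on how often each letter is read at each height. With few heights to choose from, the number of
  multisets of size at most \<open>n\<close> grows at an exponential rate close to \<open>1\<close>, hence below \<open>\<omega>\<close>.

  High paths are rare for a different reason (\<open>card_high_class\<close>). Fix \<open>a \<in> A\<close>. Cut the path at a
  large height: \<open>g = P Q\<close>, where the paths of \<open>P\<close> and of \<open>Q\<^sup>-\<^sup>1\<close> both run from \<open>0\<close> to that height. For
  a set \<open>J\<close> of \<open>k\<close> among \<open>N\<close> equally spaced heights on the way, let \<open>S\<close> be the product of the
  translates of \<open>a\<close> to these heights. Both paths come close to each of these heights, and a copy of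
  \<open>a\<close> can be inserted there at a bounded cost \<open>c\<close> (\<open>insertion_cost\<close>), so \<open>S P\<close> and \<open>S Q\<^sup>-\<^sup>1\<close> are only
  \<open>c k\<close> longer than \<open>P\<close> and \<open>Q\<close>. The pair \<open>(S P, S Q\<^sup>-\<^sup>1)\<close> determines everything: its quotient is
  \<open>S g S\<^sup>-\<^sup>1 = g\<close>, and \<open>g\<close> gives \<open>P\<close>, then \<open>S\<close>, then \<open>J\<close>. Therefore the number of such \<open>g\<close>, times
  the binomial coefficient \<open>N choose k\<close>, is at most \<open>|B(i + c k)| |B(n - i + c k)|\<close>. For \<open>N = M k\<close>
  the binomial coefficient is at least \<open>M^k\<close>, which for a large constant \<open>M\<close> exceeds the price
  \<open>\<beta>^(2 c k)\<close> of the insertions exponentially in \<open>k\<close>, and \<open>k\<close> is proportional to \<open>n\<close>.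

  The argument needs that different sets \<open>J\<close> give different products \<open>S\<close>, and this is where
  exponential growth enters (\<open>expanding_eigenvalue\<close>). If all eigenvalues of \<open>T\<close> lay in the closed
  unit disc, the entries of \<open>T^j\<close> would grow polynomially in \<open>j\<close>; every element can be written
  \<open>t^(-p) a^v t^q\<close> with \<open>p\<close> and \<open>q\<close> linear in its length and \<open>v\<close> polynomially bounded, so the
  group would have polynomial growth.
  Hence there is an eigenvalue \<open>\<mu>\<close> with \<open>|\<mu>| > 1\<close>. A left eigenvector lets the group act on the
  complex line by affine maps (\<open>affine_action\<close>), and \<open>S\<close> becomes the translation by a multiple of
  the sum of \<open>\<mu>^(\<kappa> j)\<close> over \<open>j \<in> J\<close>. Once \<open>|\<mu>|^\<kappa> \<ge> 2\<close>, such sums determine \<open>J\<close>.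
\<close>

section \<open>Word length in a finitely generated group\<close>

locale fin_gen_group = Group.group +
  fixes Y
  assumes fin_gen: "finite_generating_set G Y"
begin

abbreviation letters where "letters \<equiv> Y \<union> m_inv G ` Y"
abbreviation word_prod where "word_prod ws \<equiv> foldr (\<otimes>) ws \<one>"
abbreviation len where "len \<equiv> word_length G Y"
abbreviation ball where "ball \<equiv> word_ball G Y"

lemma finite_letters: "finite letters"
  using fin_gen by (simp add: finite_generating_set_def)

lemma letters_carrier: "letters \<subseteq> carrier G"
  using fin_gen by (auto simp: finite_generating_set_def)

lemma letters_inv: "y \<in> letters \<Longrightarrow> inv y \<in> letters"
  using fin_gen by (auto simp: finite_generating_set_def)

lemma word_prod_closed: "set ws \<subseteq> letters \<Longrightarrow> word_prod ws \<in> carrier G"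
proof (induction ws)
  case (Cons y ws)
  then have "y \<in> carrier G" "word_prod ws \<in> carrier G" using letters_carrier by auto
  then have "y \<otimes> word_prod ws \<in> carrier G" by (rule m_closed)
  then show ?case by simp
qed simp

lemma word_prod_append:
  "set us \<subseteq> letters \<Longrightarrow> set vs \<subseteq> letters \<Longrightarrow> word_prod (us @ vs) = word_prod us \<otimes> word_prod vs"
proof (induction us)
  case Nil
  then show ?case using word_prod_closed by simp
next
  case (Cons y us)
  then show ?case using word_prod_closed letters_carrier by (auto simp: m_assoc subset_eq)
qed

lemma letters_map_inv: "set ws \<subseteq> letters \<Longrightarrow> set (map (m_inv G) ws) \<subseteq> letters"
  by (induction ws) (simp_all del: Un_iff add: letters_inv)

lemma word_prod_rev_inv:
  "set ws \<subseteq> letters \<Longrightarrow> word_prod (rev (map (m_inv G) ws)) = inv (word_prod ws)"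
proof (induction ws)
  case Nil
  then show ?case by simp
next
  case (Cons y ws)
  have "set (rev (map (m_inv G) ws)) \<subseteq> letters" "set [inv y] \<subseteq> letters"
    using Cons.prems letters_map_inv[of ws] letters_inv[of y] by simp_all
  moreover have "y \<in> carrier G" using Cons.prems letters_carrier by auto
  ultimately have "word_prod (rev (map (m_inv G) (y # ws))) = word_prod (rev (map (m_inv G) ws)) \<otimes> inv y"
    using word_prod_append[of "rev (map (m_inv G) ws)" "[inv y]"] by auto
  then show ?case
    using Cons letters_carrier word_prod_closed[of ws] by (auto simp: inv_mult_group)
qed

lemma len_le: "set ws \<subseteq> letters \<Longrightarrow> len (word_prod ws) \<le> length ws"
  unfolding word_length_def by (rule Least_le) auto

lemma word_exists:
  assumes "g \<in> carrier G"
  shows "\<exists>ws. set ws \<subseteq> letters \<and> word_prod ws = g"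
proof -
  have "g \<in> generate G Y" using assms fin_gen by (simp add: finite_generating_set_def)
  then show ?thesis
  proof (induction rule: generate.induct)
    case one
    then show ?case by (intro exI[of _ "[]"]) simp
  next
    case (incl h)
    then show ?case using letters_carrier by (intro exI[of _ "[h]"]) auto
  next
    case (inv h)
    then show ?case using letters_carrier by (intro exI[of _ "[inv h]"]) auto
  next
    case (eng h1 h2)
    then obtain us vs where "set us \<subseteq> letters" "word_prod us = h1"
      "set vs \<subseteq> letters" "word_prod vs = h2" by blast
    then show ?case by (intro exI[of _ "us @ vs"]) (simp del: foldr_append add: word_prod_append)
  qed
qed

lemma geodesic_word:
  assumes "g \<in> carrier G"
  obtains ws where "set ws \<subseteq> letters" "word_prod ws = g" "length ws = len g"
proof -
  have "\<exists>n ws. length ws = n \<and> set ws \<subseteq> letters \<and> word_prod ws = g"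
    using word_exists[OF assms] by blast
  from LeastI_ex[OF this] show ?thesis
    using that unfolding word_length_def by blast
qed

lemma len_one: "len \<one> = 0"
  using len_le[of "[]"] by simp

lemma len_mult: "g \<in> carrier G \<Longrightarrow> h \<in> carrier G \<Longrightarrow> len (g \<otimes> h) \<le> len g + len h"
proof -
  assume "g \<in> carrier G" "h \<in> carrier G"
  then obtain us vs where "set us \<subseteq> letters" "word_prod us = g" "length us = len g"
      "set vs \<subseteq> letters" "word_prod vs = h" "length vs = len h"
    using geodesic_word by metis
  then show ?thesis using len_le[of "us @ vs"] by (simp del: foldr_append add: word_prod_append)
qed

lemma len_inv: "g \<in> carrier G \<Longrightarrow> len (inv g) \<le> len g"
proof -
  assume "g \<in> carrier G"
  then obtain us where us: "set us \<subseteq> letters" "word_prod us = g" "length us = len g"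
    using geodesic_word by metis
  have "set (rev (map (m_inv G) us)) \<subseteq> letters" using us letters_inv by auto
  from len_le[OF this] show ?thesis using us word_prod_rev_inv[OF us(1)] by simp
qed

lemma len_pow: "g \<in> carrier G \<Longrightarrow> len (g [^] (k::nat)) \<le> k * len g"
proof (induction k)
  case (Suc k)
  then show ?case using len_mult[of "g [^] k" g] by simp
qed (simp add: len_one)

lemma ball_iff: "g \<in> ball n \<longleftrightarrow> g \<in> carrier G \<and> len g \<le> n"
  by (simp add: word_ball_def)

lemma finite_ball: "finite (ball n)"
proof (rule finite_subset)
  show "ball n \<subseteq> word_prod ` {ws. set ws \<subseteq> letters \<and> length ws \<le> n}"
  proof
    fix g assume g: "g \<in> ball n"
    then have "g \<in> carrier G" by (simp add: ball_iff)
    from geodesic_word[OF this] obtain ws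
      where "set ws \<subseteq> letters" "word_prod ws = g" "length ws = len g" .
    with g show "g \<in> word_prod ` {ws. set ws \<subseteq> letters \<and> length ws \<le> n}"
      by (auto simp: ball_iff)
  qed
  show "finite (word_prod ` {ws. set ws \<subseteq> letters \<and> length ws \<le> n})"
    by (intro finite_imageI finite_lists_length_le finite_letters)
qed

lemma card_ball_pos: "1 \<le> card (ball n)"
proof -
  have "\<one> \<in> ball n" by (simp add: ball_iff len_one)
  then have "0 < card (ball n)" using finite_ball card_gt_0_iff by blast
  then show ?thesis by simp
qed

lemma split_geodesic:
  assumes "g \<in> carrier G" "len g \<le> m + n"
  obtains u v where "u \<in> ball m" "v \<in> ball n" "g = u \<otimes> v"
proof -
  obtain ws where ws: "set ws \<subseteq> letters" "word_prod ws = g" "length ws = len g"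
    using geodesic_word assms(1) by metis
  have s: "set (take m ws) \<subseteq> letters" "set (drop m ws) \<subseteq> letters"
    using ws(1) by (meson set_take_subset set_drop_subset order_trans)+
  have "word_prod (take m ws @ drop m ws) = g" using ws by simp
  moreover have "word_prod (take m ws) \<in> ball m" "word_prod (drop m ws) \<in> ball n"
    using len_le[OF s(1)] len_le[OF s(2)] word_prod_closed s ws(3) assms(2)
    by (auto simp: ball_iff)
  ultimately show ?thesis using that word_prod_append[OF s] by metis
qed

lemma card_ball_add: "card (ball (m + n)) \<le> card (ball m) * card (ball n)"
proof -
  have "ball (m + n) \<subseteq> (\<lambda>(u, v). u \<otimes> v) ` (ball m \<times> ball n)"
  proof
    fix g assume "g \<in> ball (m + n)"
    then have "g \<in> carrier G" "len g \<le> m + n" by (simp_all add: ball_iff)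
    from split_geodesic[OF this] obtain u v where "u \<in> ball m" "v \<in> ball n" "g = u \<otimes> v" .
    then show "g \<in> (\<lambda>(u, v). u \<otimes> v) ` (ball m \<times> ball n)" by blast
  qed
  then have "card (ball (m + n)) \<le> card ((\<lambda>(u, v). u \<otimes> v) ` (ball m \<times> ball n))"
    by (intro card_mono) (auto simp: finite_ball)
  also have "\<dots> \<le> card (ball m \<times> ball n)"
    by (intro card_image_le) (auto simp: finite_ball)
  finally show ?thesis by (simp add: card_cartesian_product)
qed

lemma card_ball_mono: "m \<le> n \<Longrightarrow> card (ball m) \<le> card (ball n)"
  by (intro card_mono finite_ball) (auto simp: ball_iff)

lemma card_ball_mult: "card (ball (q * n)) \<le> card (ball n) ^ q"
proof (induction q)
  case 0
  have "ball 0 \<subseteq> {\<one>}"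
  proof
    fix g assume g: "g \<in> ball 0"
    then have "g \<in> carrier G" by (simp add: ball_iff)
    from geodesic_word[OF this] obtain ws where "word_prod ws = g" "length ws = len g" .
    with g show "g \<in> {\<one>}" unfolding ball_iff by auto
  qed
  then have "card (ball 0) \<le> card {\<one>}" by (intro card_mono) auto
  then show ?case by simp
next
  case (Suc q)
  have "card (ball (Suc q * n)) \<le> card (ball n) * card (ball (q * n))"
    using card_ball_add[of n "q * n"] by simp
  also have "\<dots> \<le> card (ball n) * card (ball n) ^ q" using Suc by simp
  finally show ?case by simp
qed

text \<open>The growth rate as an infimum rather than a limit: this gives the lower bound
  \<open>growth_rate ^ n\<close> for every \<open>n\<close>, and by submultiplicativity an upper bound up to an
  arbitrarily small loss in the base.\<close>

definition growth_rate :: real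
  where "growth_rate = (INF n\<in>{1..}. root n (real (card (ball n))))"

lemma growth_rate_bdd: "bdd_below ((\<lambda>n. root n (real (card (ball n)))) ` {1..})"
  by (rule bdd_belowI[of _ 0]) auto

lemma growth_rate_ge_1: "1 \<le> growth_rate"
  unfolding growth_rate_def
proof (rule cINF_greatest)
  fix n :: nat assume "n \<in> {1..}"
  then show "1 \<le> root n (real (card (ball n)))"
    using card_ball_pos[of n] by (simp)
qed simp

lemma growth_rate_power_le: "growth_rate ^ n \<le> card (ball n)"
proof (cases "n = 0")
  case True
  then show ?thesis using card_ball_pos[of n] by simp
next
  case False
  then have "growth_rate \<le> root n (real (card (ball n)))"
    unfolding growth_rate_def by (intro cINF_lower growth_rate_bdd) auto
  then have "growth_rate ^ n \<le> root n (real (card (ball n))) ^ n"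
    using growth_rate_ge_1 by (intro power_mono) auto
  then show ?thesis using False by simp
qed

lemma card_ball_le_power:
  fixes \<beta> :: real
  assumes "growth_rate < \<beta>"
  obtains C :: real where "1 \<le> C" "\<And>n. card (ball n) \<le> C * \<beta> ^ n"
proof -
  have "\<exists>k\<in>{1..}. root k (real (card (ball k))) < \<beta>"
    by (rule iffD1[OF cINF_less_iff[OF _ growth_rate_bdd, of \<beta>]])
      (use assms in \<open>simp_all add: growth_rate_def\<close>)
  then obtain k where k: "1 \<le> k" "root k (real (card (ball k))) < \<beta>" by auto
  have b: "1 \<le> \<beta>" using assms growth_rate_ge_1 by simp
  have bk: "real (card (ball k)) \<le> \<beta> ^ k"
  proof -
    have "root k (real (card (ball k))) ^ k \<le> \<beta> ^ k"
      using k by (intro power_mono) auto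
    then show ?thesis using k(1) by simp
  qed
  show ?thesis
  proof
    show "1 \<le> real (card (ball k))" using card_ball_pos[of k] by simp
    fix n
    have "card (ball n) \<le> card (ball (n div k * k + k))"
    proof (rule card_ball_mono)
      have "n = n div k * k + n mod k" by simp
      also have "\<dots> \<le> n div k * k + k" using k(1) by (intro add_left_mono) simp
      finally show "n \<le> n div k * k + k" .
    qed
    also have "\<dots> \<le> card (ball k) ^ (n div k) * card (ball k)"
      using card_ball_add[of "n div k * k" k] card_ball_mult[of "n div k" k]
      by (meson mult_le_mono1 order_trans)
    finally have "card (ball n) \<le> card (ball k) * card (ball k) ^ (n div k)"
      by (simp only: mult.commute)
    then have "real (card (ball n)) \<le> real (card (ball k)) * real (card (ball k)) ^ (n div k)"
      unfolding of_nat_power[symmetric] of_nat_mult[symmetric] by (rule of_nat_mono)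
    also have "\<dots> \<le> real (card (ball k)) * (\<beta> ^ k) ^ (n div k)"
      using bk by (intro mult_left_mono power_mono) auto
    also have "\<dots> \<le> real (card (ball k)) * \<beta> ^ n"
      unfolding power_mult[symmetric] using b by (intro mult_left_mono power_increasing) auto
    finally show "real (card (ball n)) \<le> real (card (ball k)) * \<beta> ^ n" .
  qed
qed

end

section \<open>Extensions of an infinite cyclic group by an abelian group\<close>

locale abelian_by_cyclic = Group.group +
  fixes \<tau> :: "'a \<Rightarrow> int" and t
  assumes tau_mult: "x \<in> carrier G \<Longrightarrow> y \<in> carrier G \<Longrightarrow> \<tau> (x \<otimes> y) = \<tau> x + \<tau> y"
    and t_carrier: "t \<in> carrier G"
    and tau_t: "\<tau> t = 1"
    and ker_comm: "x \<in> carrier G \<Longrightarrow> y \<in> carrier G \<Longrightarrow> \<tau> x = 0 \<Longrightarrow> \<tau> y = 0 \<Longrightarrow> x \<otimes> y = y \<otimes> x"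
begin

lemma tau_one: "\<tau> \<one> = 0"
  using tau_mult[of \<one> \<one>] by simp

lemma tau_inv: "x \<in> carrier G \<Longrightarrow> \<tau> (inv x) = - \<tau> x"
  using tau_mult[of x "inv x"] tau_one by simp

lemma tau_nat_pow: "x \<in> carrier G \<Longrightarrow> \<tau> (x [^] (n::nat)) = int n * \<tau> x"
  by (induction n) (auto simp: tau_one tau_mult algebra_simps)

lemma tau_t_pow: "\<tau> (t [^] (h::int)) = h"
proof (cases h)
  case (nonneg n)
  then show ?thesis using tau_nat_pow[OF t_carrier] tau_t by (simp add: int_pow_int)
next
  case (neg n)
  then have "t [^] h = inv (t [^] Suc n)"
    using t_carrier by (simp only: int_pow_neg_int)
  then show ?thesis
    using neg t_carrier tau_nat_pow[OF t_carrier, of "Suc n"] tau_t by (simp only: tau_inv nat_pow_closed mult_1_right)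
qed

definition ker where "ker = {x \<in> carrier G. \<tau> x = 0}"

lemma ker_carrier: "x \<in> ker \<Longrightarrow> x \<in> carrier G"
  by (simp add: ker_def)

lemma ker_mult: "x \<in> ker \<Longrightarrow> y \<in> ker \<Longrightarrow> x \<otimes> y \<in> ker"
  by (simp add: ker_def tau_mult)

lemma one_ker: "\<one> \<in> ker"
  by (simp add: ker_def tau_one)

lemma ker_commute: "x \<in> ker \<Longrightarrow> y \<in> ker \<Longrightarrow> x \<otimes> y = y \<otimes> x"
  by (simp add: ker_def ker_comm)

lemma comm_monoid_ker: "comm_monoid (G\<lparr>carrier := ker\<rparr>)"
  by (rule comm_monoidI) (simp_all add: ker_mult one_ker m_assoc ker_carrier, erule (1) ker_commute)

definition shift :: "int \<Rightarrow> 'a \<Rightarrow> 'a"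
  where "shift h x = t [^] h \<otimes> x \<otimes> inv (t [^] h)"

lemma shift_ker: "x \<in> ker \<Longrightarrow> shift h x \<in> ker"
  using t_carrier by (simp add: ker_def shift_def tau_mult tau_inv)

lemma t_pow_mult_ker: "x \<in> carrier G \<Longrightarrow> t [^] h \<otimes> x = shift h x \<otimes> t [^] h"
  using t_carrier by (simp add: shift_def m_assoc)

text \<open>The kernel being abelian, an element acts on it by conjugation only through its height.\<close>

lemma mult_ker_eq_shift:
  assumes p: "p \<in> carrier G" and x: "x \<in> ker"
  shows "p \<otimes> x = shift (\<tau> p) x \<otimes> p"
proof -
  define T where "T = t [^] \<tau> p"
  define b where "b = p \<otimes> inv T"
  have T: "T \<in> carrier G" using t_carrier by (simp add: T_def)
  have b: "b \<in> ker" using p T by (simp add: b_def ker_def tau_mult tau_inv) (simp add: T_def tau_t_pow)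
  have pb: "p = b \<otimes> T" using p T by (simp add: b_def m_assoc)
  have bc: "b \<in> carrier G" "x \<in> carrier G" using b x by (auto simp: ker_def)
  have s: "shift (\<tau> p) x \<in> ker" by (rule shift_ker[OF x])
  have "p \<otimes> x = b \<otimes> (T \<otimes> x)" unfolding pb using bc T by (simp add: m_assoc)
  also have "T \<otimes> x = shift (\<tau> p) x \<otimes> T" using t_pow_mult_ker[OF bc(2)] by (simp add: T_def)
  also have "b \<otimes> (shift (\<tau> p) x \<otimes> T) = (b \<otimes> shift (\<tau> p) x) \<otimes> T"
    using m_assoc[OF bc(1) ker_carrier[OF s] T] by simp
  also have "\<dots> = shift (\<tau> p) x \<otimes> b \<otimes> T" using ker_commute[OF b s] by simp
  also have "\<dots> = shift (\<tau> p) x \<otimes> p" using m_assoc[OF ker_carrier[OF s] bc(1) T] pb by simp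
  finally show ?thesis .
qed

lemma shift_mult:
  assumes "x \<in> carrier G" "y \<in> carrier G"
  shows "shift h (x \<otimes> y) = shift h x \<otimes> shift h y"
proof -
  have "T \<otimes> (x \<otimes> y) \<otimes> inv T = T \<otimes> x \<otimes> inv T \<otimes> (T \<otimes> y \<otimes> inv T)" if T: "T \<in> carrier G" for T
    using assms T inv_solve_left'[of "y \<otimes> inv T" T "T \<otimes> (y \<otimes> inv T)"] by (simp add: m_assoc)
  then show ?thesis using t_carrier by (simp add: shift_def)
qed

lemma shift_one: "shift h \<one> = \<one>"
  using t_carrier by (simp add: shift_def)

lemma shift_add:
  assumes "x \<in> carrier G"
  shows "shift (h + k) x = shift h (shift k x)"
  using assms t_carrier by (simp add: shift_def m_assoc int_pow_mult inv_mult_group)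

lemma inj_on_shift: "inj_on (shift h) (carrier G)"
  using t_carrier by (simp add: inj_on_def shift_def)

text \<open>The product of the translates of \<open>a\<close> to the heights \<open>\<kappa> j\<close> with \<open>j \<in> J\<close>. It is a recursion rather than
  a product over \<open>J\<close> because only the kernel, not the group, is commutative.\<close>

primrec spread :: "'a \<Rightarrow> int \<Rightarrow> nat set \<Rightarrow> nat \<Rightarrow> 'a" where
  "spread a \<kappa> J 0 = \<one>"
| "spread a \<kappa> J (Suc N) = (if N \<in> J then shift (\<kappa> * int N) a else \<one>) \<otimes> spread a \<kappa> J N"

lemma spread_ker: "a \<in> ker \<Longrightarrow> spread a \<kappa> J N \<in> ker"
  by (induction N) (auto simp: one_ker shift_ker ker_mult)

end

text \<open>The injectivity says that the translates of \<open>a\<close> to the multiples of \<open>\<kappa>\<close> are independent for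
  coefficients \<open>0\<close> and \<open>1\<close>. It makes the insertions below numerous, and it already implies
  exponential growth.\<close>
locale spreading = abelian_by_cyclic +
  fixes a :: 'a and \<kappa> :: int
  assumes a_ker: "a \<in> ker"
    and kappa_pos: "1 \<le> \<kappa>"
    and spread_inj: "\<And>N. inj_on (\<lambda>J. spread a \<kappa> J N) (Pow {..<N})"

section \<open>Multisets of bounded size\<close>

text \<open>Each multiset is weighted by \<open>z\<close> to the power of its size. The weighted count over all multisets
  factors into geometric series, one for each point of \<open>D\<close>. For \<open>z\<close> close to \<open>1\<close> and \<open>D\<close> small
  compared with \<open>n\<close>, the resulting exponential rate in \<open>n\<close> is close to \<open>1\<close>.\<close>
lemma card_multisets_le:
  fixes z :: real
  assumes "finite D" "0 < z" "z < 1"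
  shows "finite {M. set_mset M \<subseteq> D \<and> size M \<le> n}"
    and "card {M. set_mset M \<subseteq> D \<and> size M \<le> n} * z ^ n \<le> (1 / (1 - z)) ^ card D"
proof -
  let ?W = "{M. set_mset M \<subseteq> D \<and> size M \<le> n}" and ?P = "PiE D (\<lambda>_. {..n})"
  let ?r = "\<lambda>M. restrict (count M) D"
  have inj: "inj_on ?r ?W"
  proof (rule inj_onI, rule multiset_eqI)
    fix M M' d assume *: "M \<in> ?W" "M' \<in> ?W" "?r M = ?r M'"
    show "count M d = count M' d"
    proof (cases "d \<in> D")
      case True
      then show ?thesis using fun_cong[OF *(3), of d] by simp
    next
      case False
      then have "d \<notin># M" "d \<notin># M'" using *(1,2) by auto
      then show ?thesis by (simp add: not_in_iff)
    qed
  qed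
  have sub: "?r ` ?W \<subseteq> ?P"
  proof
    fix f assume "f \<in> ?r ` ?W"
    then obtain M where M: "size M \<le> n" "f = ?r M" by auto
    have "count M d \<le> n" for d using count_le_size[of M d] M(1) by simp
    then show "f \<in> ?P" using M(2) by auto
  qed
  have finP: "finite ?P" using assms(1) by (intro finite_PiE) auto
  show fin: "finite ?W" using inj sub finP by (meson finite_imageD finite_subset)
  have size: "size M = (\<Sum>d\<in>D. count M d)" if "M \<in> ?W" for M
    unfolding size_multiset_overloaded_eq using that assms(1)
    by (intro sum.mono_neutral_left) (auto simp: count_eq_zero_iff)
  have geo: "(\<Sum>k\<le>n. z ^ k) \<le> 1 / (1 - z)"
  proof -
    have "(\<Sum>k\<le>n. z ^ k) = (1 - z ^ Suc n) / (1 - z)" using assms(3) sum_gp0[of z n] by simp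
    also have "\<dots> \<le> 1 / (1 - z)" using assms by (intro divide_right_mono) auto
    finally show ?thesis .
  qed
  have "card ?W * z ^ n = (\<Sum>M\<in>?W. z ^ n)" by simp
  also have "\<dots> \<le> (\<Sum>M\<in>?W. z ^ size M)"
    by (intro sum_mono power_decreasing) (use assms in simp_all)
  also have "\<dots> = (\<Sum>M\<in>?W. \<Prod>d\<in>D. z ^ ?r M d)"
  proof (rule sum.cong[OF HOL.refl])
    fix M assume "M \<in> ?W"
    then have "z ^ size M = z ^ (\<Sum>d\<in>D. count M d)" by (simp only: size)
    also have "\<dots> = (\<Prod>d\<in>D. z ^ ?r M d)" by (simp add: power_sum)
    finally show "z ^ size M = (\<Prod>d\<in>D. z ^ ?r M d)" .
  qed
  also have "\<dots> = (\<Sum>f\<in>?r ` ?W. \<Prod>d\<in>D. z ^ f d)"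
    by (subst sum.reindex[OF inj]) simp
  also have "\<dots> \<le> (\<Sum>f\<in>?P. \<Prod>d\<in>D. z ^ f d)"
    using assms sub finP by (intro sum_mono2) (auto intro!: prod_nonneg)
  also have "\<dots> = (\<Prod>d\<in>D. \<Sum>k\<le>n. z ^ k)"
    using assms(1) by (subst prod_sum_PiE) auto
  also have "\<dots> \<le> (1 / (1 - z)) ^ card D"
    using geo assms by (simp add: power_mono sum_nonneg)
  finally show "card ?W * z ^ n \<le> (1 / (1 - z)) ^ card D" .
qed

section \<open>Words as paths of heights\<close>
definition between_zero_and :: "int \<Rightarrow> int \<Rightarrow> bool"
  where "between_zero_and x h \<longleftrightarrow> (0 \<le> h \<and> h \<le> x) \<or> (x \<le> h \<and> h \<le> 0)"

locale abelian_by_cyclic_fg = abelian_by_cyclic + fin_gen_group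
begin

lemma tau_letters_bounded: obtains s :: nat where "\<And>y. y \<in> letters \<Longrightarrow> \<bar>\<tau> y\<bar> \<le> int s"
proof
  fix y assume "y \<in> letters"
  then have "nat \<bar>\<tau> y\<bar> \<le> Max ((\<lambda>y. nat \<bar>\<tau> y\<bar>) ` letters)"
    using finite_letters by (intro Max_ge) auto
  then show "\<bar>\<tau> y\<bar> \<le> int (Max ((\<lambda>y. nat \<bar>\<tau> y\<bar>) ` letters))" by linarith
qed

text \<open>A discrete intermediate value argument: the heights along the word move by at most \<open>s\<close> per letter.\<close>
lemma prefix_near_height:
  assumes s: "\<And>y. y \<in> letters \<Longrightarrow> \<bar>\<tau> y\<bar> \<le> int s"
  shows "set ws \<subseteq> letters \<Longrightarrow> between_zero_and (\<tau> (word_prod ws)) h \<Longrightarrow>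
    \<exists>us vs. ws = us @ vs \<and> \<bar>h - \<tau> (word_prod us)\<bar> \<le> int s"
proof (induction ws rule: rev_induct)
  case Nil
  then show ?case by (auto simp: between_zero_and_def tau_one)
next
  case (snoc y ws)
  have ws: "set ws \<subseteq> letters" and y: "y \<in> letters" "y \<in> carrier G"
    using snoc.prems letters_carrier by auto
  show ?case
  proof (cases "between_zero_and (\<tau> (word_prod ws)) h")
    case True
    from snoc.IH[OF ws this] show ?thesis by (metis append.assoc)
  next
    case False
    have "word_prod (ws @ [y]) = word_prod ws \<otimes> y"
      using word_prod_append[of ws "[y]"] ws y by simp
    then have "\<tau> (word_prod (ws @ [y])) = \<tau> (word_prod ws) + \<tau> y"
      using word_prod_closed[OF ws] y tau_mult by metis
    with False snoc.prems(2) s[OF y(1)] have "\<bar>h - \<tau> (word_prod (ws @ [y]))\<bar> \<le> int s"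
      unfolding between_zero_and_def by linarith
    then show ?thesis by (intro exI[of _ "ws @ [y]"] exI[of _ "[]"]) simp
  qed
qed

text \<open>The path of a geodesic word for \<open>u\<close> passes within bounded distance of the height \<open>h\<close>. Inserted at that
  point, the translate of \<open>a\<close> is one of finitely many conjugates of \<open>a\<close>, so its length is bounded.
  Commuting the insertion back to the front of \<open>u\<close> restores the height \<open>h\<close>.\<close>

lemma insertion_cost:
  assumes a: "a \<in> ker"
  obtains c :: nat where
    "\<And>u h. u \<in> carrier G \<Longrightarrow> between_zero_and (\<tau> u) h \<Longrightarrow> len (shift h a \<otimes> u) \<le> len u + c"
proof -
  obtain s where s: "\<And>y. y \<in> letters \<Longrightarrow> \<bar>\<tau> y\<bar> \<le> int s" using tau_letters_bounded by blast
  define c where "c = Max ((\<lambda>i. len (shift i a)) ` {- int s..int s})"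
  have c: "len (shift i a) \<le> c" if "\<bar>i\<bar> \<le> int s" for i
    unfolding c_def using that by (intro Max_ge imageI) auto
  show ?thesis
  proof
    fix u h assume u: "u \<in> carrier G" and h: "between_zero_and (\<tau> u) h"
    from geodesic_word[OF u] obtain ws
      where ws: "set ws \<subseteq> letters" "word_prod ws = u" "length ws = len u" .
    obtain us vs where uv: "ws = us @ vs" "\<bar>h - \<tau> (word_prod us)\<bar> \<le> int s"
      using prefix_near_height[OF s ws(1), of h] ws(2) h by auto
    define P Q where "P = word_prod us" and "Q = word_prod vs"
    have us: "set us \<subseteq> letters" and vs: "set vs \<subseteq> letters" using ws uv by auto
    have P: "P \<in> carrier G" "len P \<le> length us" and Q: "Q \<in> carrier G" "len Q \<le> length vs"
      using us vs by (simp_all add: P_def Q_def word_prod_closed len_le)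
    define f where "f = shift (h - \<tau> P) a"
    have f: "f \<in> ker" "f \<in> carrier G" using a by (auto simp: f_def shift_ker ker_carrier)
    have "len f \<le> c" unfolding f_def using c uv(2) by (simp add: P_def)
    have u_eq: "u = P \<otimes> Q"
      using word_prod_append[OF us vs] ws(2) uv(1) by (simp add: P_def Q_def)
    have "shift h a = shift (\<tau> P) f"
      unfolding f_def using shift_add[OF ker_carrier[OF a], of "\<tau> P" "h - \<tau> P"] by simp
    then have "shift h a \<otimes> P = P \<otimes> f" using mult_ker_eq_shift[OF P(1) f(1)] by simp
    then have "shift h a \<otimes> u = P \<otimes> (f \<otimes> Q)"
      using P Q f ker_carrier[OF shift_ker[OF a]] by (simp add: u_eq flip: m_assoc)
    then have "len (shift h a \<otimes> u) \<le> len P + (len f + len Q)"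
      using len_mult[of P "f \<otimes> Q"] len_mult[of f Q] P Q f by simp
    then show "len (shift h a \<otimes> u) \<le> len u + c"
      using \<open>len f \<le> c\<close> P Q ws(3) uv(1) by simp
  qed
qed

section \<open>Elements carried by a narrow range of heights\<close>

text \<open>A letter \<open>y\<close> is the product of its part \<open>base y\<close> in the kernel and a power of \<open>t\<close>. Moving all
  powers of \<open>t\<close> to the right turns a word into a product of conjugates of kernel parts, each moved
  to the height at which its letter is read. The list \<open>heights 0 ws\<close> records these pairs.\<close>

definition base :: "'a \<Rightarrow> 'a" where "base y = y \<otimes> inv (t [^] \<tau> y)"

lemma base_ker: "y \<in> carrier G \<Longrightarrow> base y \<in> ker"
  using t_carrier by (simp add: base_def ker_def tau_mult tau_inv tau_t_pow)

primrec heights :: "int \<Rightarrow> 'a list \<Rightarrow> (int \<times> 'a) list" where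
  "heights h [] = []"
| "heights h (y # ws) = (h, y) # heights (h + \<tau> y) ws"

definition height_prod :: "(int \<times> 'a) list \<Rightarrow> 'a"
  where "height_prod xs = foldr (\<otimes>) (map (\<lambda>(h, y). shift h (base y)) xs) \<one>"

lemma height_prod_ker: "snd ` set xs \<subseteq> letters \<Longrightarrow> height_prod xs \<in> ker"
  by (induction xs)
    (use letters_carrier in \<open>auto simp: height_prod_def one_ker intro!: ker_mult shift_ker base_ker\<close>)

lemma length_heights: "length (heights h ws) = length ws"
  by (induction ws arbitrary: h) auto

lemma snd_heights: "snd ` set (heights h ws) = set ws"
  by (induction ws arbitrary: h) auto

lemma t_pow_mult_word_prod:
  "set ws \<subseteq> letters \<Longrightarrow>
    t [^] h \<otimes> word_prod ws = height_prod (heights h ws) \<otimes> t [^] (h + \<tau> (word_prod ws))"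
proof (induction ws arbitrary: h)
  case Nil
  then show ?case using t_carrier by (simp add: height_prod_def tau_one)
next
  case (Cons y ws)
  let ?p = "word_prod ws"
  have y: "y \<in> carrier G" and ws: "set ws \<subseteq> letters" and p: "?p \<in> carrier G"
    using Cons.prems letters_carrier word_prod_closed[of ws] by auto
  have k: "height_prod (heights (h + \<tau> y) ws) \<in> carrier G"
    using ws by (intro ker_carrier height_prod_ker) (simp add: snd_heights)
  have b: "base y \<in> carrier G" "shift h (base y) \<in> carrier G"
    using base_ker[OF y] shift_ker ker_carrier by auto
  have "t [^] h \<otimes> word_prod (y # ws) = t [^] h \<otimes> base y \<otimes> (t [^] \<tau> y \<otimes> ?p)"
  proof -
    have "base y \<otimes> t [^] \<tau> y = y" using y t_carrier by (simp add: base_def m_assoc)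
    then have "t [^] h \<otimes> word_prod (y # ws) = t [^] h \<otimes> (base y \<otimes> t [^] \<tau> y \<otimes> ?p)" by simp
    then show ?thesis using b p t_carrier by (simp add: m_assoc)
  qed
  also have "\<dots> = shift h (base y) \<otimes> (t [^] (h + \<tau> y) \<otimes> ?p)"
    unfolding t_pow_mult_ker[OF b(1)] using b p t_carrier by (simp add: m_assoc int_pow_mult)
  also have "t [^] (h + \<tau> y) \<otimes> ?p =
      height_prod (heights (h + \<tau> y) ws) \<otimes> t [^] (h + \<tau> y + \<tau> ?p)"
    by (rule Cons.IH[OF ws])
  finally show ?case
    using b k t_carrier y p by (simp add: height_prod_def tau_mult m_assoc add.assoc)
qed


lemma height_prod_mset_cong:
  assumes "mset xs = mset ys" "snd ` set xs \<subseteq> letters"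
  shows "height_prod xs = height_prod ys"
proof -
  interpret K: comm_monoid "G\<lparr>carrier := ker\<rparr>" by (rule comm_monoid_ker)
  let ?f = "\<lambda>(h, y). shift h (base y)"
  have "mset (map ?f xs) = mset (map ?f ys)" using assms(1) by simp
  moreover have "set (map ?f xs) \<subseteq> ker"
  proof
    fix x assume "x \<in> set (map ?f xs)"
    then obtain h y where hy: "(h, y) \<in> set xs" "x = shift h (base y)" by auto
    then have "y \<in> letters" using assms(2) by force
    then show "x \<in> ker" using hy(2) letters_carrier by (auto intro: shift_ker base_ker)
  qed
  ultimately show ?thesis
    unfolding height_prod_def using K.multlist_perm_cong[of "map ?f xs" "map ?f ys"] by simp
qed


definition low_words :: "nat \<Rightarrow> nat \<Rightarrow> 'a list set"
  where "low_words H n = {ws. set ws \<subseteq> letters \<and> length ws \<le> n \<and>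
    (\<forall>us vs. ws = us @ vs \<longrightarrow> \<bar>\<tau> (word_prod us)\<bar> \<le> int H)}"

lemma heights_low_words:
  assumes "set ws \<subseteq> letters" "\<And>us vs. ws = us @ vs \<Longrightarrow> \<bar>h + \<tau> (word_prod us)\<bar> \<le> int H"
  shows "set (heights h ws) \<subseteq> {- int H..int H} \<times> letters"
  using assms
proof (induction ws arbitrary: h)
  case Nil
  then show ?case by simp
next
  case (Cons y ws)
  have y: "y \<in> letters" "y \<in> carrier G" and ws: "set ws \<subseteq> letters"
    using Cons.prems(1) letters_carrier by auto
  have "\<bar>h + \<tau> y + \<tau> (word_prod us)\<bar> \<le> int H" if "ws = us @ vs" for us vs
  proof -
    have "word_prod us \<in> carrier G" using ws that by (intro word_prod_closed) auto
    then show ?thesis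
      using Cons.prems(2)[of "y # us" vs] that y by (simp add: tau_mult add.assoc)
  qed
  from Cons.IH[OF ws this] have "set (heights (h + \<tau> y) ws) \<subseteq> {- int H..int H} \<times> letters" .
  moreover have "\<bar>h\<bar> \<le> int H" using Cons.prems(2)[of "[]" "y # ws"] by (simp add: tau_one)
  ultimately show ?case using y(1) by auto
qed

text \<open>The kernel is abelian, so an element spelled by a word depends only on the multiset of pairs of a
  height and a letter that the word visits.\<close>
lemma card_low_elements_le:
  fixes z :: real
  assumes z: "0 < z" "z < 1"
  shows "card (ker \<inter> word_prod ` low_words H n) * z ^ n \<le>
    (1 / (1 - z)) ^ ((2 * H + 1) * card letters)"
proof -
  let ?D = "{- int H..int H} \<times> letters"
  let ?W = "{M. set_mset M \<subseteq> ?D \<and> size M \<le> n}"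
  let ?f = "\<lambda>M. height_prod (SOME xs. mset xs = M)"
  have fin: "finite ?D" using finite_letters by simp
  note W = card_multisets_le[OF fin z, of n]
  have "ker \<inter> word_prod ` low_words H n \<subseteq> ?f ` ?W"
  proof
    fix g assume "g \<in> ker \<inter> word_prod ` low_words H n"
    then obtain ws where g: "g \<in> ker" "g = word_prod ws" and ws: "ws \<in> low_words H n" by auto
    let ?xs = "heights 0 ws"
    have sub: "set ws \<subseteq> letters" using ws by (simp add: low_words_def)
    have D: "set ?xs \<subseteq> ?D"
      by (rule heights_low_words[OF sub]) (use ws in \<open>auto simp: low_words_def\<close>)
    have k: "height_prod ?xs \<in> carrier G"
      using D by (intro ker_carrier height_prod_ker) auto
    have "g = height_prod ?xs"
      using t_pow_mult_word_prod[OF sub, of 0] g k ker_carrier[OF g(1)] t_carrier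
      by (simp add: ker_def)
    also have "\<dots> = ?f (mset ?xs)"
    proof (rule height_prod_mset_cong)
      show "mset ?xs = mset (SOME xs. mset xs = mset ?xs)" by (metis (mono_tags) someI)
      show "snd ` set ?xs \<subseteq> letters" using sub by (simp add: snd_heights)
    qed
    finally show "g \<in> ?f ` ?W"
      using D ws by (intro rev_image_eqI[of "mset ?xs"]) (auto simp: length_heights low_words_def)
  qed
  then have "card (ker \<inter> word_prod ` low_words H n) \<le> card ?W"
    using card_mono[of "?f ` ?W"] card_image_le[OF W(1), of ?f] W(1) by (meson finite_imageI order_trans)
  then have "card (ker \<inter> word_prod ` low_words H n) * z ^ n \<le> card ?W * z ^ n"
    using z by (intro mult_right_mono) auto
  also have "\<dots> \<le> (1 / (1 - z)) ^ card ?D" by (rule W(2))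
  also have "card ?D = (2 * H + 1) * card letters" 
    unfolding card_cartesian_product by (simp add: nat_add_distrib nat_mult_distrib)
  finally show ?thesis .
qed

end

section \<open>Inserting translates along a path\<close>
locale spreading_fg = spreading + abelian_by_cyclic_fg
begin

abbreviation shifted_spread :: "int \<Rightarrow> nat set \<Rightarrow> nat \<Rightarrow> 'a"
  where "shifted_spread e J N \<equiv> shift e (spread a \<kappa> J N)"

lemma shifted_spread_ker: "shifted_spread e J N \<in> ker"
  by (intro shift_ker spread_ker a_ker)

lemma shifted_spread_inj:
  assumes "shifted_spread e J N = shifted_spread e J' N" "J \<subseteq> {..<N}" "J' \<subseteq> {..<N}"
  shows "J = J'"
proof -
  have "spread a \<kappa> J N = spread a \<kappa> J' N"
    using assms(1) inj_onD[OF inj_on_shift] spread_ker[OF a_ker] ker_carrier by metis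
  then show ?thesis using inj_onD[OF spread_inj[of N]] assms(2,3) by blast
qed

text \<open>Multiplying by an element of the kernel leaves the total height of \<open>u\<close> unchanged, so the insertions can
  be made one after the other, each at the same cost.\<close>
lemma len_shifted_spread_mult:
  assumes c: "\<And>u h. u \<in> carrier G \<Longrightarrow> between_zero_and (\<tau> u) h \<Longrightarrow> len (shift h a \<otimes> u) \<le> len u + c"
    and u: "u \<in> carrier G"
  shows "(\<And>j. j < N \<Longrightarrow> between_zero_and (\<tau> u) (e + \<kappa> * int j)) \<Longrightarrow>
    len (shifted_spread e J N \<otimes> u) \<le> len u + c * card (J \<inter> {..<N})"
proof (induction N)
  case 0
  then show ?case using u by (simp add: shift_one)
next
  case (Suc N)
  let ?v = "shifted_spread e J N \<otimes> u"
  have v: "?v \<in> carrier G" "\<tau> ?v = \<tau> u"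
    using shifted_spread_ker[of e J N] u by (auto simp: ker_def tau_mult)
  have IH: "len ?v \<le> len u + c * card (J \<inter> {..<N})"
    using Suc by simp
  show ?case
  proof (cases "N \<in> J")
    case True
    have "shifted_spread e J (Suc N) = shift e (shift (\<kappa> * int N) a) \<otimes> shifted_spread e J N"
      using True a_ker by (simp add: shift_mult shift_ker spread_ker ker_carrier)
    then have "shifted_spread e J (Suc N) \<otimes> u = shift (e + \<kappa> * int N) a \<otimes> ?v"
      using a_ker u by (simp add: shift_add ker_carrier shift_ker spread_ker m_assoc)
    moreover have "len (shift (e + \<kappa> * int N) a \<otimes> ?v) \<le> len ?v + c"
      using v Suc.prems[of N] by (intro c) auto
    moreover have "J \<inter> {..<Suc N} = insert N (J \<inter> {..<N})" using True by auto
    then have "card (J \<inter> {..<Suc N}) = Suc (card (J \<inter> {..<N}))" by simp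
    ultimately show ?thesis using IH by simp
  next
    case False
    then have "J \<inter> {..<Suc N} = J \<inter> {..<N}" by (auto simp: less_Suc_eq)
    moreover have "shifted_spread e J (Suc N) = shifted_spread e J N"
      using False spread_ker[OF a_ker] ker_carrier by simp
    ultimately show ?thesis using IH by simp
  qed
qed

text \<open>Inserting arbitrary sets of translates on the way up to height \<open>\<kappa> N\<close> gives \<open>2 ^ N\<close> elements whose
  length is linear in \<open>N\<close>.\<close>
lemma growth_rate_gt_1: "1 < growth_rate"
proof (rule ccontr)
  obtain c where c: "\<And>u h. u \<in> carrier G \<Longrightarrow> between_zero_and (\<tau> u) h \<Longrightarrow> len (shift h a \<otimes> u) \<le> len u + c"
    using insertion_cost[OF a_ker] by blast
  define d where "d = nat \<kappa> * len t + c + 1"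
  define \<beta> where "\<beta> = root d (3 / 2)"
  have many: "2 ^ N \<le> card (ball (d * N))" for N
  proof -
    define u where "u = t [^] (nat \<kappa> * N)"
    have u: "u \<in> carrier G" "\<tau> u = \<kappa> * int N"
      using t_carrier kappa_pos by (simp_all add: u_def tau_nat_pow tau_t)
    have "shifted_spread 0 J N \<otimes> u \<in> ball (d * N)" for J
    proof -
      have "card (J \<inter> {..<N}) \<le> N" using card_mono[of "{..<N}" "J \<inter> {..<N}"] by simp
      moreover have "len u \<le> nat \<kappa> * N * len t" unfolding u_def by (rule len_pow[OF t_carrier])
      moreover have "len (shifted_spread 0 J N \<otimes> u) \<le> len u + c * card (J \<inter> {..<N})"
        using kappa_pos u by (intro len_shifted_spread_mult[OF c]) (auto simp: between_zero_and_def)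
      moreover have "c * card (J \<inter> {..<N}) \<le> c * N" using calculation(1) by simp
      ultimately have "len (shifted_spread 0 J N \<otimes> u) \<le> nat \<kappa> * N * len t + c * N" by linarith
      also have "\<dots> \<le> d * N" by (simp add: d_def algebra_simps)
      finally show ?thesis using u ker_carrier[OF shifted_spread_ker] by (simp add: ball_iff)
    qed
    moreover have "inj_on (\<lambda>J. shifted_spread 0 J N \<otimes> u) (Pow {..<N})"
    proof (rule inj_onI)
      fix J J' assume J: "J \<in> Pow {..<N}" "J' \<in> Pow {..<N}" "shifted_spread 0 J N \<otimes> u = shifted_spread 0 J' N \<otimes> u"
      then have "shifted_spread 0 J N = shifted_spread 0 J' N" using u ker_carrier[OF shifted_spread_ker] by simp
      then show "J = J'" using J by (intro shifted_spread_inj) auto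
    qed
    ultimately have "card (Pow {..<N}) \<le> card (ball (d * N))"
      by (intro card_inj_on_le[of "\<lambda>J. shifted_spread 0 J N \<otimes> u"] finite_ball) auto
    then show ?thesis by (simp add: card_Pow)
  qed
  have d: "0 < d" by (simp add: d_def)
  have "1 < \<beta>" using d by (simp add: \<beta>_def)
  moreover assume "\<not> 1 < growth_rate"
  ultimately have "growth_rate < \<beta>" by simp
  then obtain C where C: "1 \<le> C" "\<And>n. card (ball n) \<le> C * \<beta> ^ n" using card_ball_le_power by blast
  obtain N where N: "C < (4 / 3) ^ N" using real_arch_pow[of "4 / 3" C] by auto
  have "2 ^ N \<le> real (card (ball (d * N)))" using of_nat_mono[OF many[of N], where 'a = real] by simp
  also have "\<dots> \<le> C * (\<beta> ^ d) ^ N" using C(2)[of "d * N"] by (simp add: power_mult)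
  also have "\<beta> ^ d = 3 / 2" using d by (simp add: \<beta>_def)
  also have "C * (3 / 2) ^ N < (4 / 3) ^ N * (3 / 2) ^ N" using N by (intro mult_strict_right_mono) auto
  also have "\<dots> = (2 :: real) ^ N" by (simp flip: power_mult_distrib)
  finally show False by simp
qed

text \<open>The heights \<open>e + \<kappa> l\<close> have to lie on the way from \<open>0\<close> to the height of the cut. The offset \<open>e\<close> is
  \<open>0\<close> for a cut at a positive height and \<open>- \<kappa> N\<close> for a cut at a negative height.\<close>
definition high_class :: "int \<Rightarrow> nat \<Rightarrow> nat \<Rightarrow> nat \<Rightarrow> 'a set"
  where "high_class e N i j = {g \<in> ker. \<exists>P\<in>ball i. \<exists>Q\<in>ball j. g = P \<otimes> Q \<and>
    (\<forall>l<N. between_zero_and (\<tau> P) (e + \<kappa> * int l))}"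

lemma finite_high_class: "finite (high_class e N i j)"
proof (rule finite_subset)
  show "high_class e N i j \<subseteq> (\<lambda>(P, Q). P \<otimes> Q) ` (ball i \<times> ball j)"
    by (auto simp: high_class_def)
qed (simp add: finite_ball)

text \<open>Since \<open>g = P Q\<close> has height \<open>0\<close>, both \<open>P\<close> and the inverse of \<open>Q\<close> end at the same height, and the same
  translates of \<open>a\<close> can be inserted into both. The quotient of the two new elements is still \<open>g\<close>,
  so every \<open>g\<close> and every choice of \<open>k\<close> among \<open>N\<close> heights give a different pair.\<close>
lemma card_high_class:
  assumes c: "\<And>u h. u \<in> carrier G \<Longrightarrow> between_zero_and (\<tau> u) h \<Longrightarrow> len (shift h a \<otimes> u) \<le> len u + c"
  shows "card (high_class e N i j) * (N choose k) \<le> card (ball (i + c * k)) * card (ball (j + c * k))"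
proof -
  let ?X = "high_class e N i j" and ?J = "{J. J \<subseteq> {..<N} \<and> card J = k}"
  have "\<forall>g\<in>?X. \<exists>P Q. P \<in> ball i \<and> Q \<in> ball j \<and> g = P \<otimes> Q \<and> (\<forall>l<N. between_zero_and (\<tau> P) (e + \<kappa> * int l))"
    unfolding high_class_def by blast
  then obtain P Q where PQ: "\<And>g. g \<in> ?X \<Longrightarrow> P g \<in> ball i \<and> Q g \<in> ball j \<and> g = P g \<otimes> Q g \<and>
      (\<forall>l<N. between_zero_and (\<tau> (P g)) (e + \<kappa> * int l))"
    by (metis (no_types))
  define f where "f = (\<lambda>(g, J). (shifted_spread e J N \<otimes> P g, shifted_spread e J N \<otimes> inv (Q g)))"
  have car: "P g \<in> carrier G" "Q g \<in> carrier G" if "g \<in> ?X" for g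
    using PQ[OF that] by (auto simp: ball_iff)
  have "f ` (?X \<times> ?J) \<subseteq> ball (i + c * k) \<times> ball (j + c * k)"
  proof (clarsimp simp: f_def)
    fix g J assume g: "g \<in> ?X" and J: "J \<subseteq> {..<N}" and k: "k = card J"
    have S: "shifted_spread e J N \<in> carrier G" using shifted_spread_ker ker_carrier by blast
    have JN: "J \<inter> {..<N} = J" using J by auto
    note pq = PQ[OF g] and cr = car[OF g]
    have "\<tau> g = 0" using g by (simp add: high_class_def ker_def)
    moreover have "\<tau> g = \<tau> (P g) + \<tau> (Q g)" using pq cr tau_mult by metis
    ultimately have tQ: "\<tau> (inv (Q g)) = \<tau> (P g)" using cr by (simp add: tau_inv)
    have "len (shifted_spread e J N \<otimes> P g) \<le> len (P g) + c * card (J \<inter> {..<N})"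
      using pq by (intro len_shifted_spread_mult[OF c cr(1)]) auto
    moreover have "len (shifted_spread e J N \<otimes> inv (Q g)) \<le> len (inv (Q g)) + c * card (J \<inter> {..<N})"
      using pq tQ by (intro len_shifted_spread_mult[OF c inv_closed[OF cr(2)]]) auto
    moreover have "len (inv (Q g)) \<le> len (Q g)" by (rule len_inv[OF cr(2)])
    ultimately show "shifted_spread e J N \<otimes> P g \<in> ball (i + c * card J) \<and>
        shifted_spread e J N \<otimes> inv (Q g) \<in> ball (j + c * card J)"
      using pq cr S by (simp add: ball_iff JN)
  qed
  moreover have "inj_on f (?X \<times> ?J)"
  proof (rule inj_onI, clarify)
    fix g J g' J'
    assume g: "g \<in> ?X" and g': "g' \<in> ?X" and J: "J \<subseteq> {..<N}" and J': "J' \<subseteq> {..<N}"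
      and eq: "f (g, J) = f (g', J')"
    \<comment> \<open>The quotient of the two components is a conjugate of \<open>g\<close> by an element of the abelian kernel.\<close>
    have recover: "fst (f (h, I)) \<otimes> inv (snd (f (h, I))) = h" if h: "h \<in> ?X" for h I
    proof -
      have S: "shifted_spread e I N \<in> ker" "shifted_spread e I N \<in> carrier G" using shifted_spread_ker ker_carrier by blast+
      have hk: "h \<in> ker" "h \<in> carrier G" using h by (auto simp: high_class_def ker_def)
      have "fst (f (h, I)) \<otimes> inv (snd (f (h, I))) = shifted_spread e I N \<otimes> (P h \<otimes> Q h) \<otimes> inv (shifted_spread e I N)"
        using S car[OF h] by (simp add: f_def inv_mult_group m_assoc)
      also have "P h \<otimes> Q h = h" using PQ[OF h] by simp
      also have "shifted_spread e I N \<otimes> h = h \<otimes> shifted_spread e I N" by (rule ker_commute[OF S(1) hk(1)])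
      finally show ?thesis using S hk by (simp add: m_assoc)
    qed
    have gg: "g = g'" using recover[OF g, of J] recover[OF g', of J'] eq by simp
    then have "shifted_spread e J N \<otimes> P g = shifted_spread e J' N \<otimes> P g" using eq by (simp add: f_def)
    then have "shifted_spread e J N = shifted_spread e J' N" using car[OF g] ker_carrier[OF shifted_spread_ker] by simp
    with gg show "g = g' \<and> J = J'" using shifted_spread_inj J J' by blast
  qed
  ultimately have "card (?X \<times> ?J) \<le> card (ball (i + c * k) \<times> ball (j + c * k))"
    by (intro card_inj_on_le) (auto simp: finite_ball)
  then show ?thesis by (simp add: card_cartesian_product n_subsets)
qed

text \<open>Either all prefixes of a geodesic word stay low, or the word can be cut at a prefix of large height.\<close>
lemma ker_ball_cover:
  "ker \<inter> ball n \<subseteq> (ker \<inter> word_prod ` low_words (nat \<kappa> * N) n) \<union>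
    (\<Union>i\<le>n. high_class 0 N i (n - i) \<union> high_class (- \<kappa> * int N) N i (n - i))"
proof
  fix g assume g: "g \<in> ker \<inter> ball n"
  then have "g \<in> carrier G" by (simp add: ball_iff)
  from geodesic_word[OF this] obtain ws
    where ws: "set ws \<subseteq> letters" "word_prod ws = g" "length ws = len g" .
  have n: "length ws \<le> n" using g ws(3) by (simp add: ball_iff)
  show "g \<in> (ker \<inter> word_prod ` low_words (nat \<kappa> * N) n) \<union>
      (\<Union>i\<le>n. high_class 0 N i (n - i) \<union> high_class (- \<kappa> * int N) N i (n - i))"
  proof (cases "ws \<in> low_words (nat \<kappa> * N) n")
    case True
    then show ?thesis using g ws(2) by blast
  next
    case False
    then obtain us vs where uv: "ws = us @ vs" and "\<not> \<bar>\<tau> (word_prod us)\<bar> \<le> int (nat \<kappa> * N)"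
      using ws n by (auto simp: low_words_def)
    then have high: "\<kappa> * int N < \<bar>\<tau> (word_prod us)\<bar>" using kappa_pos by simp
    have s: "set us \<subseteq> letters" "set vs \<subseteq> letters" using ws(1) uv by auto
    let ?i = "length us"
    have P: "word_prod us \<in> ball ?i" and Q: "word_prod vs \<in> ball (n - ?i)"
      using s n uv len_le[OF s(1)] len_le[OF s(2)] by (auto simp: ball_iff word_prod_closed)
    have gPQ: "g = word_prod us \<otimes> word_prod vs" using word_prod_append[OF s] ws(2) uv by simp
    have step: "0 \<le> \<kappa> * int l \<and> \<kappa> * int l \<le> \<kappa> * int N" if "l < N" for l
      using that kappa_pos by simp
    show ?thesis
    proof (cases "0 \<le> \<tau> (word_prod us)")
      case True
      have "between_zero_and (\<tau> (word_prod us)) (0 + \<kappa> * int l)" if "l < N" for l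
        using step[OF that] high True unfolding between_zero_and_def by linarith
      then have "g \<in> high_class 0 N ?i (n - ?i)"
        using g P Q gPQ unfolding high_class_def by blast
      then show ?thesis using n uv by auto
    next
      case False
      have "between_zero_and (\<tau> (word_prod us)) (- \<kappa> * int N + \<kappa> * int l)" if "l < N" for l
        using step[OF that] high False unfolding between_zero_and_def by (simp add: algebra_simps)
      then have "g \<in> high_class (- \<kappa> * int N) N ?i (n - ?i)"
        using g P Q gPQ unfolding high_class_def by blast
      then show ?thesis using n uv by auto
    qed
  qed
qed

end

section \<open>The kernel is exponentially negligible\<close>
lemma limsup_root_ratio_less_1:
  fixes x y :: "nat \<Rightarrow> real"
  assumes \<theta>: "0 < \<theta>" "\<theta> < 1" and \<omega>: "0 < \<omega>"
    and x: "\<And>n. 0 \<le> x n" "\<And>n. x n \<le> C * real (n + 1) * \<theta> ^ n * \<omega> ^ n"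
    and y: "\<And>n. \<omega> ^ n \<le> y n"
  shows "limsup (\<lambda>n. ereal (root n (x n / y n))) < 1"
proof -
  define \<eta> where "\<eta> = (1 + \<theta>) / 2"
  define q where "q = \<theta> / \<eta>"
  have \<eta>: "0 < \<eta>" "\<eta> < 1" "\<theta> < \<eta>" using \<theta> by (auto simp: \<eta>_def)
  then have q: "0 < q" "q < 1" using \<theta> by (auto simp: q_def)
  have "(\<lambda>n. real n * q ^ n + q ^ n) \<longlonglongrightarrow> 0 + 0"
    using q by (intro tendsto_add powser_times_n_limit_0 LIMSEQ_power_zero) auto
  then have "(\<lambda>n. C * (real n * q ^ n + q ^ n)) \<longlonglongrightarrow> C * (0 + 0)"
    by (rule tendsto_mult_left)
  then have "eventually (\<lambda>n. C * (real n * q ^ n + q ^ n) < 1) sequentially"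
    by (intro order_tendstoD(2)) auto
  then have "eventually (\<lambda>n. ereal (root n (x n / y n)) \<le> ereal \<eta>) sequentially"
    using eventually_gt_at_top[of 0]
  proof eventually_elim
    case (elim n)
    have "x n / y n \<le> x n / \<omega> ^ n"
      using x(1) y \<omega> by (intro divide_left_mono mult_pos_pos) (auto intro: less_le_trans[of _ "\<omega> ^ n"])
    also have "\<dots> \<le> C * real (n + 1) * \<theta> ^ n"
      using x(2)[of n] \<omega> by (simp add: divide_le_eq)
    also have "\<theta> = q * \<eta>" using \<eta> by (simp add: q_def)
    also have "C * real (n + 1) * (q * \<eta>) ^ n = C * (real n * q ^ n + q ^ n) * \<eta> ^ n"
      by (simp add: power_mult_distrib algebra_simps)
    also have "\<dots> \<le> 1 * \<eta> ^ n" using elim \<eta> by (intro mult_right_mono) auto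
    finally have "root n (x n / y n) \<le> root n (\<eta> ^ n)" using elim by simp
    also have "\<dots> = \<eta>" using elim \<eta> by (simp add: real_root_power_cancel)
    finally show ?case by simp
  qed
  then have "limsup (\<lambda>n. ereal (root n (x n / y n))) \<le> ereal \<eta>" by (rule Limsup_bounded)
  also have "\<dots> < 1" using \<eta> by simp
  finally show ?thesis .
qed

context spreading_fg
begin

text \<open>The constants are chosen in the order \<open>M\<close>, \<open>K\<close>, \<open>\<beta>\<close>. First, \<open>M\<close> is large enough for the factor
  \<open>M ^ k\<close> to beat the cost of the insertions with a margin of \<open>2 ^ k\<close>. Next, \<open>k\<close> is \<open>n div K\<close>, with \<open>K\<close>
  so large that the low elements, whose heights are at most \<open>\<kappa> M k\<close>, number at most a constant times
  \<open>\<omega> ^ (3 n / 4)\<close>. Finally, \<open>\<beta>\<close> is so close to \<open>\<omega>\<close> that the margin \<open>2 ^ k\<close> outweighs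
  \<open>(\<beta> / \<omega>) ^ n\<close>.\<close>
theorem ker_exponentially_negligible: "exponentially_negligible G Y ker"
proof -
  obtain c where c: "\<And>u h. u \<in> carrier G \<Longrightarrow> between_zero_and (\<tau> u) h \<Longrightarrow> len (shift h a \<otimes> u) \<le> len u + c"
    using insertion_cost[OF a_ker] by blast
  define \<omega> where "\<omega> = growth_rate"
  define r where "r = root 4 \<omega>"
  define S where "S = card letters"
  define B where "B = 1 / (1 - 1 / r\<^sup>2)"
  have \<omega>: "1 < \<omega>" using growth_rate_gt_1 by (simp add: \<omega>_def)
  then have r: "1 < r" and r4: "r ^ 4 = \<omega>" by (simp_all add: r_def)
  have r2: "1 < r\<^sup>2" using r by (simp add: one_less_power)
  then have z: "0 < 1 / r\<^sup>2" "1 / r\<^sup>2 < 1" using r by (simp_all add: divide_less_eq)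
  then have B: "1 \<le> B" by (simp add: B_def field_simps)
  \<comment> \<open>The bound \<open>2 \<omega>\<close> stands in for \<open>\<beta>\<close>, which is chosen only after \<open>M\<close>.\<close>
  obtain M :: nat where M: "2 * (2 * \<omega>) ^ (2 * c) \<le> real M" using real_arch_simple by blast
  define E where "E = B ^ (2 * nat \<kappa> * M * S)"
  obtain K0 where "E < r ^ K0" using real_arch_pow[OF r] by blast
  moreover define K where "K = K0 + 1"
  moreover have "r ^ K0 \<le> r ^ K" using r by (intro power_increasing) (auto simp: K_def)
  ultimately have E: "E \<le> r ^ K" and K: "0 < K" by simp_all
  \<comment> \<open>With this \<open>w\<close>, the gain \<open>2 ^ k\<close> is about \<open>w ^ (2 * n)\<close>, while \<open>\<beta> ^ n\<close> exceeds \<open>\<omega> ^ n\<close>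
    only by \<open>w ^ n\<close>.\<close>
  define w where "w = root (2 * K) 2"
  define \<beta> where "\<beta> = \<omega> * w"
  have w: "1 < w" "w ^ (2 * K) = 2" "w \<le> 2"
  proof -
    show "1 < w" "w ^ (2 * K) = 2" using K by (simp_all add: w_def)
    then have "w ^ 1 \<le> w ^ (2 * K)" using K by (intro power_increasing) auto
    then show "w \<le> 2" using \<open>w ^ (2 * K) = 2\<close> by simp
  qed
  have \<beta>: "\<omega> < \<beta>" "\<beta> \<le> 2 * \<omega>" "1 < \<beta>"
  proof -
    show "\<omega> < \<beta>" using w \<omega> by (simp add: \<beta>_def)
    then show "1 < \<beta>" using \<omega> by simp
    show "\<beta> \<le> 2 * \<omega>" using w \<omega> by (simp add: \<beta>_def)
  qed
  obtain C where C: "1 \<le> C" "\<And>n. card (ball n) \<le> C * \<beta> ^ n"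
    using card_ball_le_power[of \<beta>] \<beta>(1) unfolding \<omega>_def by blast
  define \<theta> where "\<theta> = max (1 / r) (1 / w)"
  have \<theta>: "0 < \<theta>" "\<theta> < 1" "1 / r \<le> \<theta>" "1 / w \<le> \<theta>"
    using r w by (auto simp: \<theta>_def less_max_iff_disj)

  have bound: "card (ker \<inter> ball n) \<le> (B ^ S + 4 * C\<^sup>2) * real (n + 1) * \<theta> ^ n * \<omega> ^ n" for n
  proof -
    define k where "k = n div K"
    define N where "N = M * k"
    have k: "K * k \<le> n" "n \<le> K * k + K"
      using mult_div_mod_eq[of K n] mod_less_divisor[OF K, of n] unfolding k_def by linarith+
    let ?low = "ker \<inter> word_prod ` low_words (nat \<kappa> * N) n"
    let ?hi = "\<lambda>i. high_class 0 N i (n - i) \<union> high_class (- \<kappa> * int N) N i (n - i)"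
    have low: "card ?low \<le> B ^ S * \<theta> ^ n * \<omega> ^ n"
    proof -
      have "card ?low * (1 / r\<^sup>2) ^ n \<le> B ^ ((2 * (nat \<kappa> * N) + 1) * S)"
        using card_low_elements_le[OF z] unfolding B_def S_def .
      also have "\<dots> = B ^ S * E ^ k"
        by (simp add: E_def N_def algebra_simps flip: power_mult power_add)
      also have "\<dots> \<le> B ^ S * (r ^ K) ^ k"
        using E B by (intro mult_left_mono power_mono) (auto simp: E_def)
      also have "\<dots> \<le> B ^ S * r ^ n"
        unfolding power_mult[symmetric] using k(1) r B by (intro mult_left_mono power_increasing) auto
      finally have "card ?low \<le> B ^ S * r ^ n * r\<^sup>2 ^ n"
        using r by (simp add: power_one_over field_simps)
      moreover have "r ^ n * r\<^sup>2 ^ n = (1 / r) ^ n * \<omega> ^ n"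
      proof -
        have "r * r\<^sup>2 = (1 / r) * r ^ 4" using r by (simp add: power2_eq_square power4_eq_xxxx)
        then show ?thesis by (simp only: r4 flip: power_mult_distrib)
      qed
      ultimately have "card ?low \<le> B ^ S * ((1 / r) ^ n * \<omega> ^ n)" by (simp only: mult.assoc)
      also have "\<dots> \<le> B ^ S * (\<theta> ^ n * \<omega> ^ n)"
        using \<theta> r B \<omega> by (intro mult_left_mono mult_right_mono power_mono) auto
      finally show ?thesis by (simp add: mult.assoc)
    qed
    have w2: "\<beta> ^ n / 2 ^ k \<le> 2 * \<theta> ^ n * \<omega> ^ n"
    proof -
      have "w ^ (2 * n) \<le> w ^ (2 * K * k + 2 * K)" using w k(2) by (intro power_increasing) auto
      also have "\<dots> = 2 * 2 ^ k" using w(2) by (simp add: power_add power_mult)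
      finally have "w ^ n * w ^ n \<le> 2 * 2 ^ k" by (simp only: mult_2 power_add)
      then have "w ^ n / 2 ^ k \<le> 2 * (1 / w) ^ n"
        using w by (simp add: power_one_over field_simps)
      also have "\<dots> \<le> 2 * \<theta> ^ n" using \<theta> w by (intro mult_left_mono power_mono) auto
      finally have "\<omega> ^ n * (w ^ n / 2 ^ k) \<le> \<omega> ^ n * (2 * \<theta> ^ n)"
        using \<omega> by (intro mult_left_mono) auto
      then show ?thesis by (simp add: \<beta>_def power_mult_distrib mult_ac)
    qed
    have high: "card (high_class e N i (n - i)) \<le> 2 * C\<^sup>2 * \<theta> ^ n * \<omega> ^ n" if "i \<le> n" for e i
    proof -
      let ?h = "real (card (high_class e N i (n - i)))"
      have "M \<noteq> 0"
      proof
        assume "M = 0"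
        moreover have "0 < (2 * \<omega>) ^ (2 * c)" using \<omega> by simp
        ultimately show False using M by simp
      qed
      have "real M ^ k \<le> real (N choose k)"
      proof (cases "k = 0")
        case False
        then have "k \<le> N" "real N / real k = real M" using \<open>M \<noteq> 0\<close> by (simp_all add: N_def)
        then show ?thesis using binomial_ge_n_over_k_pow_k[of k N, where 'a = real] by simp
      qed simp
      then have "?h * real M ^ k \<le> ?h * real (N choose k)" by (intro mult_left_mono) auto
      also have "\<dots> \<le> real (card (ball (i + c * k))) * real (card (ball (n - i + c * k)))"
        using card_high_class[OF c, of e N i "n - i" k]
        unfolding of_nat_mult[symmetric] by (rule of_nat_mono)
      also have "\<dots> \<le> (C * \<beta> ^ (i + c * k)) * (C * \<beta> ^ (n - i + c * k))"
        using C \<beta> by (intro mult_mono) auto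
      also have "\<dots> = C\<^sup>2 * \<beta> ^ ((i + c * k) + (n - i + c * k))"
        by (simp only: power_add power2_eq_square mult_ac)
      also have "(i + c * k) + (n - i + c * k) = n + 2 * c * k" using that by simp
      also have "\<beta> ^ (n + 2 * c * k) = \<beta> ^ n * (\<beta> ^ (2 * c)) ^ k"
        by (simp only: power_add power_mult)
      also have "C\<^sup>2 * (\<beta> ^ n * (\<beta> ^ (2 * c)) ^ k) \<le> C\<^sup>2 * (\<beta> ^ n * (real M / 2) ^ k)"
      proof -
        have "\<beta> ^ (2 * c) \<le> (2 * \<omega>) ^ (2 * c)" using \<beta> by (intro power_mono) auto
        then have "\<beta> ^ (2 * c) \<le> real M / 2" using M by simp
        then show ?thesis using \<beta> by (intro mult_left_mono power_mono) auto
      qed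
      also have "\<dots> = C\<^sup>2 * (\<beta> ^ n / 2 ^ k) * real M ^ k" by (simp add: power_divide)
      finally have "?h \<le> C\<^sup>2 * (\<beta> ^ n / 2 ^ k)"
        by (rule mult_right_le_imp_le) (use \<open>M \<noteq> 0\<close> in simp)
      also have "\<dots> \<le> C\<^sup>2 * (2 * \<theta> ^ n * \<omega> ^ n)" using w2 by (intro mult_left_mono) auto
      finally show ?thesis by (simp add: mult_ac)
    qed
    have "card (ker \<inter> ball n) \<le> card (?low \<union> (\<Union>i\<le>n. ?hi i))"
    proof (rule card_mono[OF _ ker_ball_cover])
      have "?low \<subseteq> ball n" by (auto simp: low_words_def ball_iff word_prod_closed intro: order_trans[OF len_le])
      then show "finite (?low \<union> (\<Union>i\<le>n. ?hi i))"
        using finite_ball finite_high_class by (auto intro: finite_subset)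
    qed
    also have "\<dots> \<le> card ?low + card (\<Union>i\<le>n. ?hi i)" by (rule card_Un_le)
    also have "\<dots> \<le> card ?low + (\<Sum>i\<le>n. card (?hi i))"
      by (intro add_left_mono card_UN_le) auto
    also have "\<dots> \<le> card ?low + (\<Sum>i\<le>n. card (high_class 0 N i (n - i)) +
        card (high_class (- \<kappa> * int N) N i (n - i)))"
      by (intro add_left_mono sum_mono card_Un_le)
    finally have "real (card (ker \<inter> ball n)) \<le> real (card ?low) + (\<Sum>i\<le>n.
        real (card (high_class 0 N i (n - i))) + real (card (high_class (- \<kappa> * int N) N i (n - i))))"
      by (simp flip: of_nat_add of_nat_sum)
    also have "\<dots> \<le> B ^ S * \<theta> ^ n * \<omega> ^ n +
        (\<Sum>i\<le>n. 2 * C\<^sup>2 * \<theta> ^ n * \<omega> ^ n + 2 * C\<^sup>2 * \<theta> ^ n * \<omega> ^ n)"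
      by (intro add_mono sum_mono low high) auto
    also have "\<dots> = B ^ S * (\<theta> ^ n * \<omega> ^ n) + real (n + 1) * (4 * C\<^sup>2 * \<theta> ^ n * \<omega> ^ n)"
      by simp
    also have "\<dots> \<le> real (n + 1) * B ^ S * (\<theta> ^ n * \<omega> ^ n) + real (n + 1) * (4 * C\<^sup>2 * \<theta> ^ n * \<omega> ^ n)"
      using \<theta> \<omega> B by (intro add_right_mono mult_right_mono) auto
    also have "\<dots> = (B ^ S + 4 * C\<^sup>2) * real (n + 1) * \<theta> ^ n * \<omega> ^ n"
      by (simp only: distrib_left distrib_right mult_ac)
    finally show ?thesis .
  qed
  have "limsup (\<lambda>n. ereal (root n (real (card (ker \<inter> ball n)) / real (card (ball n))))) < 1"
  proof (rule limsup_root_ratio_less_1[OF \<theta>(1,2)])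
    show "0 < \<omega>" using \<omega> by simp
    show "real (card (ker \<inter> ball n)) \<le> (B ^ S + 4 * C\<^sup>2) * real (n + 1) * \<theta> ^ n * \<omega> ^ n" for n
      by (rule bound)
    show "\<omega> ^ n \<le> real (card (ball n))" for n
      using growth_rate_power_le by (simp add: \<omega>_def)
  qed simp
  moreover have "ker \<subseteq> carrier G" by (auto simp: ker_def)
  ultimately show ?thesis by (simp add: exponentially_negligible_def)
qed

end

section \<open>The lattice and its normal form in \<open>G(m,T)\<close>\<close>
lemma (in Group.group) commute_inv:
  assumes "x \<in> carrier G" "y \<in> carrier G" "x \<otimes> y = y \<otimes> x"
  shows "inv x \<otimes> y = y \<otimes> inv x"
proof -
  have "x \<otimes> (inv x \<otimes> y) = x \<otimes> (y \<otimes> inv x)"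
  proof -
    have "x \<otimes> (inv x \<otimes> y) = y" using assms by (simp flip: m_assoc)
    moreover have "x \<otimes> (y \<otimes> inv x) = y"
      using assms by (simp flip: m_assoc add: assms(3)) (simp add: m_assoc assms)
    ultimately show ?thesis by simp
  qed
  then show ?thesis using assms by simp
qed

lemma (in Group.group) commute_int_pow:
  assumes "x \<in> carrier G" "y \<in> carrier G" "x \<otimes> y = y \<otimes> x"
  shows "x [^] (k :: int) \<otimes> y = y \<otimes> x [^] k"
proof (cases k)
  case (nonneg n)
  then show ?thesis using group_commutes_pow[OF assms(3,1,2), of n] by (simp add: int_pow_int)
next
  case (neg n)
  then show ?thesis
    using commute_inv[OF _ assms(2) group_commutes_pow[OF assms(3,1,2), of "Suc n"]] assms(1)
    by (simp only: int_pow_neg_int nat_pow_closed)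
qed

locale lattice_hnn =
  fixes m :: nat and T :: "int mat"
  assumes T: "T \<in> carrier_mat m m"
begin

sublocale Group.group "GmT m T" by (rule group_GmT)

abbreviation \<GG> where "\<GG> \<equiv> GmT m T"
abbreviation a where "a \<equiv> gen_a m T"
abbreviation t where "t \<equiv> gen_t m T"
abbreviation cls where "cls \<equiv> pres_class (gens m) (rels m T)"

lemma cls_closed: "w \<in> gwords (gens m) \<Longrightarrow> cls w \<in> carrier \<GG>"
  by (auto simp: GmT_def carrier_presented_group)

lemma cls_append:
  "u \<in> gwords (gens m) \<Longrightarrow> v \<in> gwords (gens m) \<Longrightarrow> cls (u @ v) = cls u \<otimes>\<^bsub>\<GG>\<^esub> cls v"
  by (simp add: GmT_def mult_presented_group)

lemma cls_Nil: "cls [] = \<one>\<^bsub>\<GG>\<^esub>"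
  by (simp add: GmT_def one_presented_group)

lemma a_closed: "i < m \<Longrightarrow> a i \<in> carrier \<GG>"
  unfolding gen_a_def pres_gen_def by (rule cls_closed) (simp add: gens_def)

lemma t_closed: "t \<in> carrier \<GG>"
  unfolding gen_t_def pres_gen_def by (rule cls_closed) (simp add: gens_def)

lemma cls_inverse_letter:
  assumes "x \<in> gens m"
  shows "cls [(x, False)] = inv\<^bsub>\<GG>\<^esub> cls [(x, True)]"
proof -
  have w: "[(x, False)] \<in> gwords (gens m)" "[(x, True)] \<in> gwords (gens m)" using assms by simp_all
  have "pres_eq (gens m) (rels m T) [(x, False), (x, True)] []"
    using pres_eq.cancel[OF assms, of "rels m T" False] by simp
  then have "cls ([(x, False)] @ [(x, True)]) = cls []"
    using assms by (subst pres_class_eq_iff) simp_all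
  then have "cls [(x, False)] \<otimes>\<^bsub>\<GG>\<^esub> cls [(x, True)] = \<one>\<^bsub>\<GG>\<^esub>"
    using cls_append[OF w] cls_Nil by simp
  from inv_equality[OF this] show ?thesis using cls_closed w by simp
qed

lemma cls_letter:
  assumes "x \<in> gens m"
  shows "cls [(x, e)] = (case x of
    GenA i \<Rightarrow> a i [^]\<^bsub>\<GG>\<^esub> (if e then 1 else -1 :: int) | GenT \<Rightarrow> t [^]\<^bsub>\<GG>\<^esub> (if e then 1 else -1 :: int))"
proof -
  have "cls [(x, True)] \<in> carrier \<GG>" using assms by (intro cls_closed) simp
  then show ?thesis
    using cls_inverse_letter[OF assms]
    by (cases e; cases x) (simp_all add: gen_a_def gen_t_def pres_gen_def int_pow_neg)
qed

lemma cls_replicate: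
  assumes "l \<in> gens m \<times> UNIV"
  shows "cls (replicate n l) = cls [l] [^]\<^bsub>\<GG>\<^esub> n"
proof (induction n)
  case 0
  show ?case by (simp add: cls_Nil)
next
  case (Suc n)
  have l: "[l] \<in> gwords (gens m)" "replicate n l \<in> gwords (gens m)"
    using assms by (auto simp: gwords_def)
  have "cls (replicate (Suc n) l) = cls (replicate n l @ [l])" by (simp add: replicate_append_same)
  also have "\<dots> = cls (replicate n l) \<otimes>\<^bsub>\<GG>\<^esub> cls [l]" by (rule cls_append[OF l(2,1)])
  finally show ?case using Suc by simp
qed

lemma cls_pow_word:
  assumes "i < m"
  shows "cls (pow_word (GenA i) k) = a i [^]\<^bsub>\<GG>\<^esub> k"
proof -
  have g: "GenA i \<in> gens m" using assms by (simp add: gens_def)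
  show ?thesis
  proof (cases k)
    case (nonneg n)
    then show ?thesis
      using g cls_replicate[of "(GenA i, True)" n]
      by (simp add: pow_word_def gen_a_def pres_gen_def int_pow_int)
  next
    case (neg n)
    have A: "a i \<in> carrier \<GG>" by (rule a_closed[OF assms])
    have "cls (pow_word (GenA i) k) = cls (replicate (Suc n) (GenA i, False))"
      unfolding pow_word_def using neg by (simp del: replicate_Suc of_nat_Suc)
    also have "\<dots> = (inv\<^bsub>\<GG>\<^esub> a i) [^]\<^bsub>\<GG>\<^esub> Suc n"
      using g cls_replicate[of "(GenA i, False)" "Suc n"] cls_inverse_letter[OF g]
      by (simp only: gen_a_def pres_gen_def mem_Times_iff fst_conv UNIV_I simp_thms snd_conv)
    also have "\<dots> = inv\<^bsub>\<GG>\<^esub> (a i [^]\<^bsub>\<GG>\<^esub> Suc n)" by (rule nat_pow_inv[OF A])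
    also have "\<dots> = a i [^]\<^bsub>\<GG>\<^esub> k" unfolding neg by (rule int_pow_neg_int[OF A, symmetric])
    finally show ?thesis .
  qed
qed

definition avec :: "int vec \<Rightarrow> gen gword set" where "avec v = cls (vec_word m v)"

primrec aprod :: "int vec \<Rightarrow> nat list \<Rightarrow> gen gword set" where
  "aprod v [] = \<one>\<^bsub>\<GG>\<^esub>"
| "aprod v (i # is) = a i [^]\<^bsub>\<GG>\<^esub> (v $ i) \<otimes>\<^bsub>\<GG>\<^esub> aprod v is"

lemma pow_word_gwords: "i < m \<Longrightarrow> pow_word (GenA i) k \<in> gwords (gens m)"
  by (auto simp: pow_word_def gwords_def gens_def)

lemma aprod_closed: "set is \<subseteq> {..<m} \<Longrightarrow> aprod v is \<in> carrier \<GG>"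
  by (induction "is") (auto simp: a_closed)

lemma avec_eq_aprod: "avec v = aprod v [0..<m]"
proof -
  have "set is \<subseteq> {..<m} \<Longrightarrow> concat (map (\<lambda>i. pow_word (GenA i) (v $ i)) is) \<in> gwords (gens m) \<and>
      cls (concat (map (\<lambda>i. pow_word (GenA i) (v $ i)) is)) = aprod v is" for "is"
    by (induction "is") (auto simp: cls_Nil cls_append cls_pow_word pow_word_gwords)
  then show ?thesis by (simp add: avec_def vec_word_def atLeast0LessThan)
qed

lemma avec_closed: "avec v \<in> carrier \<GG>"
  unfolding avec_eq_aprod by (rule aprod_closed) auto

lemma cls_rel:
  assumes "(u, v) \<in> rels m T"
  shows "cls u = cls v"
proof -
  have uv: "u \<in> gwords (gens m)" "v \<in> gwords (gens m)" using assms rels_gwords by auto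
  have "pres_eq (gens m) (rels m T) u v" by (rule pres_eq.rel[OF assms uv])
  then show ?thesis using pres_class_eq_iff[OF uv(1)] by blast
qed

lemma a_commute:
  assumes "i < m" "j < m"
  shows "a i \<otimes>\<^bsub>\<GG>\<^esub> a j = a j \<otimes>\<^bsub>\<GG>\<^esub> a i"
proof -
  have *: "a i \<otimes>\<^bsub>\<GG>\<^esub> a j = a j \<otimes>\<^bsub>\<GG>\<^esub> a i" if "i < j" "j < m" for i j
  proof -
    have g: "[(GenA i, True)] \<in> gwords (gens m)" "[(GenA j, True)] \<in> gwords (gens m)"
      using that by (auto simp: gens_def)
    have "cls ([(GenA i, True)] @ [(GenA j, True)]) = cls ([(GenA j, True)] @ [(GenA i, True)])"
      using that by (intro cls_rel) (auto simp: rels_def)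
    then show ?thesis unfolding cls_append[OF g] cls_append[OF g(2,1)] gen_a_def pres_gen_def .
  qed
  show ?thesis using *[of i j] *[of j i] assms by (cases i j rule: linorder_cases) auto
qed

lemma a_pow_commute:
  assumes "i < m" "j < m"
  shows "a i [^]\<^bsub>\<GG>\<^esub> (k :: int) \<otimes>\<^bsub>\<GG>\<^esub> a j [^]\<^bsub>\<GG>\<^esub> (l :: int) = a j [^]\<^bsub>\<GG>\<^esub> l \<otimes>\<^bsub>\<GG>\<^esub> a i [^]\<^bsub>\<GG>\<^esub> k"
  using commute_int_pow[OF a_closed[OF assms(1)] int_pow_closed[OF a_closed[OF assms(2)]]
      commute_int_pow[OF a_closed[OF assms(2)] a_closed[OF assms(1)] a_commute[OF assms(2,1)], symmetric]] .

lemma a_pow_aprod_commute: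
  assumes "i < m"
  shows "set is \<subseteq> {..<m} \<Longrightarrow>
    a i [^]\<^bsub>\<GG>\<^esub> (k :: int) \<otimes>\<^bsub>\<GG>\<^esub> aprod v is = aprod v is \<otimes>\<^bsub>\<GG>\<^esub> a i [^]\<^bsub>\<GG>\<^esub> k"
proof (induction "is")
  case Nil
  then show ?case using a_closed[OF assms] by simp
next
  case (Cons j "is")
  let ?x = "a i [^]\<^bsub>\<GG>\<^esub> k" and ?y = "a j [^]\<^bsub>\<GG>\<^esub> (v $ j)" and ?z = "aprod v is"
  have j: "j < m" "set is \<subseteq> {..<m}" using Cons.prems by auto
  have c: "?x \<in> carrier \<GG>" "?y \<in> carrier \<GG>" "?z \<in> carrier \<GG>"
    using a_closed assms j aprod_closed by auto
  have "?x \<otimes>\<^bsub>\<GG>\<^esub> (?y \<otimes>\<^bsub>\<GG>\<^esub> ?z) = (?x \<otimes>\<^bsub>\<GG>\<^esub> ?y) \<otimes>\<^bsub>\<GG>\<^esub> ?z" using m_assoc[OF c] by simp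
  also have "\<dots> = ?y \<otimes>\<^bsub>\<GG>\<^esub> (?x \<otimes>\<^bsub>\<GG>\<^esub> ?z)"
    using m_assoc[OF c(2,1,3)] a_pow_commute[OF assms j(1)] by simp
  also have "?x \<otimes>\<^bsub>\<GG>\<^esub> ?z = ?z \<otimes>\<^bsub>\<GG>\<^esub> ?x" by (rule Cons.IH[OF j(2)])
  also have "?y \<otimes>\<^bsub>\<GG>\<^esub> (?z \<otimes>\<^bsub>\<GG>\<^esub> ?x) = ?y \<otimes>\<^bsub>\<GG>\<^esub> ?z \<otimes>\<^bsub>\<GG>\<^esub> ?x" using m_assoc[OF c(2,3,1)] by simp
  finally show ?case by simp
qed

lemma avec_add:
  assumes "u \<in> carrier_vec m" "v \<in> carrier_vec m"
  shows "avec (u + v) = avec u \<otimes>\<^bsub>\<GG>\<^esub> avec v"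
proof -
  have "set is \<subseteq> {..<m} \<Longrightarrow> aprod (u + v) is = aprod u is \<otimes>\<^bsub>\<GG>\<^esub> aprod v is" for "is"
  proof (induction "is")
    case (Cons i "is")
    let ?x = "a i [^]\<^bsub>\<GG>\<^esub> (u $ i)" and ?y = "a i [^]\<^bsub>\<GG>\<^esub> (v $ i)"
    have i: "i < m" "set is \<subseteq> {..<m}" using Cons.prems by auto
    have c: "?x \<in> carrier \<GG>" "?y \<in> carrier \<GG>" "aprod u is \<in> carrier \<GG>" "aprod v is \<in> carrier \<GG>"
      using a_closed i aprod_closed by auto
    have "a i [^]\<^bsub>\<GG>\<^esub> ((u + v) $ i) = ?x \<otimes>\<^bsub>\<GG>\<^esub> ?y"
      using i assms int_pow_mult[OF a_closed[OF i(1)]] by simp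
    then have "aprod (u + v) (i # is) = (?x \<otimes>\<^bsub>\<GG>\<^esub> ?y) \<otimes>\<^bsub>\<GG>\<^esub> (aprod u is \<otimes>\<^bsub>\<GG>\<^esub> aprod v is)"
      using Cons.IH[OF i(2)] by simp
    also have "\<dots> = ?x \<otimes>\<^bsub>\<GG>\<^esub> (?y \<otimes>\<^bsub>\<GG>\<^esub> aprod u is) \<otimes>\<^bsub>\<GG>\<^esub> aprod v is"
      using c by (simp add: m_assoc)
    also have "?y \<otimes>\<^bsub>\<GG>\<^esub> aprod u is = aprod u is \<otimes>\<^bsub>\<GG>\<^esub> ?y" by (rule a_pow_aprod_commute[OF i])
    finally show ?case using c by (simp add: m_assoc)
  qed simp
  then show ?thesis by (simp add: avec_eq_aprod atLeast0LessThan)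
qed

lemma avec_commute:
  "u \<in> carrier_vec m \<Longrightarrow> v \<in> carrier_vec m \<Longrightarrow> avec u \<otimes>\<^bsub>\<GG>\<^esub> avec v = avec v \<otimes>\<^bsub>\<GG>\<^esub> avec u"
  using avec_add[of u v] avec_add[of v u] comm_add_vec[of u m v] by simp

lemma avec_zero: "avec (0\<^sub>v m) = \<one>\<^bsub>\<GG>\<^esub>"
proof -
  have "set is \<subseteq> {..<m} \<Longrightarrow> aprod (0\<^sub>v m) is = \<one>\<^bsub>\<GG>\<^esub>" for "is" by (induction "is") auto
  then show ?thesis by (simp add: avec_eq_aprod atLeast0LessThan)
qed

lemma avec_unit:
  assumes "i < m"
  shows "avec (e \<cdot>\<^sub>v unit_vec m i) = a i [^]\<^bsub>\<GG>\<^esub> e"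
proof -
  have *: "set is \<subseteq> {..<m} \<Longrightarrow> distinct is \<Longrightarrow>
      aprod (e \<cdot>\<^sub>v unit_vec m i) is = (if i \<in> set is then a i [^]\<^bsub>\<GG>\<^esub> e else \<one>\<^bsub>\<GG>\<^esub>)" for "is"
    using assms by (induction "is") (auto simp: a_closed unit_vec_def)
  show ?thesis using *[of "[0..<m]"] assms by (simp add: avec_eq_aprod atLeast0LessThan)
qed

lemma t_avec:
  assumes "u \<in> carrier_vec m"
  shows "t \<otimes>\<^bsub>\<GG>\<^esub> avec u = avec (T *\<^sub>v u) \<otimes>\<^bsub>\<GG>\<^esub> t"
proof -
  have g: "[(GenT, True)] \<in> gwords (gens m)" "[(GenT, False)] \<in> gwords (gens m)"
    by (simp_all add: gens_def)
  have "cls ([(GenT, True)] @ vec_word m u @ [(GenT, False)]) = avec (T *\<^sub>v u)"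
    unfolding avec_def using assms by (intro cls_rel) (auto simp: rels_def)
  moreover have "cls ([(GenT, True)] @ vec_word m u @ [(GenT, False)]) =
      cls [(GenT, True)] \<otimes>\<^bsub>\<GG>\<^esub> (avec u \<otimes>\<^bsub>\<GG>\<^esub> cls [(GenT, False)])"
    unfolding avec_def using g vec_word_gwords[of m u]
    by (simp del: append_Cons append_Nil add: cls_append)
  moreover have "cls [(GenT, True)] = t" by (simp add: gen_t_def pres_gen_def)
  moreover have "cls [(GenT, False)] = inv\<^bsub>\<GG>\<^esub> t"
    using cls_inverse_letter[of GenT] by (simp add: gen_t_def pres_gen_def gens_def)
  ultimately have eq: "avec (T *\<^sub>v u) = t \<otimes>\<^bsub>\<GG>\<^esub> (avec u \<otimes>\<^bsub>\<GG>\<^esub> inv\<^bsub>\<GG>\<^esub> t)" by simp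
  show ?thesis unfolding eq using t_closed avec_closed[of u] by (simp add: m_assoc)
qed

lemma mat_pow_mult_vec_carrier: "u \<in> carrier_vec m \<Longrightarrow> (T ^\<^sub>m n) *\<^sub>v u \<in> carrier_vec m"
  using pow_carrier_mat[OF T] mult_mat_vec_carrier by blast

lemma t_pow_avec:
  assumes "u \<in> carrier_vec m"
  shows "t [^]\<^bsub>\<GG>\<^esub> n \<otimes>\<^bsub>\<GG>\<^esub> avec u = avec ((T ^\<^sub>m n) *\<^sub>v u) \<otimes>\<^bsub>\<GG>\<^esub> t [^]\<^bsub>\<GG>\<^esub> n"
  using assms
proof (induction n arbitrary: u)
  case 0
  then show ?case using avec_closed T by simp
next
  case (Suc n)
  let ?t = "t [^]\<^bsub>\<GG>\<^esub> n"
  have Tu: "T *\<^sub>v u \<in> carrier_vec m" using T Suc.prems mult_mat_vec_carrier by blast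
  have c: "?t \<in> carrier \<GG>" "t \<in> carrier \<GG>" using t_closed by auto
  have "?t \<otimes>\<^bsub>\<GG>\<^esub> t \<otimes>\<^bsub>\<GG>\<^esub> avec u = ?t \<otimes>\<^bsub>\<GG>\<^esub> avec (T *\<^sub>v u) \<otimes>\<^bsub>\<GG>\<^esub> t"
    using c avec_closed t_avec[OF Suc.prems] by (simp add: m_assoc)
  also have "\<dots> = avec ((T ^\<^sub>m n) *\<^sub>v (T *\<^sub>v u)) \<otimes>\<^bsub>\<GG>\<^esub> ?t \<otimes>\<^bsub>\<GG>\<^esub> t" by (simp only: Suc.IH[OF Tu])
  also have "(T ^\<^sub>m n) *\<^sub>v (T *\<^sub>v u) = (T ^\<^sub>m Suc n) *\<^sub>v u"
    using assoc_mult_mat_vec[OF pow_carrier_mat[OF T] T Suc.prems] by simp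
  finally show ?case using c avec_closed by (simp add: m_assoc)
qed

end

context lattice_hnn
begin

lemma tau_mult:
  "x \<in> carrier \<GG> \<Longrightarrow> y \<in> carrier \<GG> \<Longrightarrow> tau m T (x \<otimes>\<^bsub>\<GG>\<^esub> y) = tau m T x + tau m T y"
  using tau_hom[of m T] by (simp add: hom_def)

lemma tau_one: "tau m T \<one>\<^bsub>\<GG>\<^esub> = 0"
  using tau_mult[of "\<one>\<^bsub>\<GG>\<^esub>" "\<one>\<^bsub>\<GG>\<^esub>"] by simp

lemma tau_nat_pow: "x \<in> carrier \<GG> \<Longrightarrow> tau m T (x [^]\<^bsub>\<GG>\<^esub> (n :: nat)) = int n * tau m T x"
  by (induction n) (auto simp: tau_one tau_mult algebra_simps)

lemma tau_avec: "tau m T (avec v) = 0"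
proof -
  have z: "tau m T (a i [^]\<^bsub>\<GG>\<^esub> (k :: int)) = 0" if "i < m" for i k
  proof -
    have A: "a i \<in> carrier \<GG>" "tau m T (a i) = 0" using a_closed tau_hom that by auto
    have n: "tau m T (a i [^]\<^bsub>\<GG>\<^esub> (n :: nat)) = 0" for n using tau_nat_pow[OF A(1), of n] A(2) by simp
    show ?thesis
    proof (cases k)
      case (nonneg n)
      then show ?thesis using n by (simp add: int_pow_int)
    next
      case (neg n)
      let ?p = "a i [^]\<^bsub>\<GG>\<^esub> Suc n"
      have p: "?p \<in> carrier \<GG>" using A by blast
      have "tau m T (inv\<^bsub>\<GG>\<^esub> ?p) = 0"
        using tau_mult[OF inv_closed[OF p] p] n[of "Suc n"] l_inv[OF p] tau_one by (simp only: add_0_right)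
      then show ?thesis unfolding neg int_pow_neg_int[OF A(1)] .
    qed
  qed
  have "set is \<subseteq> {..<m} \<Longrightarrow> tau m T (aprod v is) = 0" for "is"
    by (induction "is") (auto simp: tau_one tau_mult z a_closed aprod_closed)
  then show ?thesis by (simp add: avec_eq_aprod atLeast0LessThan)
qed

text \<open>After multiplication by \<open>t ^ N\<close> on the left, no prefix of the word reaches a negative height. Each
  lattice letter is then moved to the front across a nonnegative power of \<open>t\<close>, where it contributes
  a signed column of a power of \<open>T\<close> to \<open>v\<close>.\<close>

lemma word_normal_form:
  assumes \<beta>: "\<forall>j p q. j \<le> 2 * N \<longrightarrow> p < m \<longrightarrow> q < m \<longrightarrow> \<bar>(T ^\<^sub>m j) $$ (p, q)\<bar> \<le> \<beta>"
  shows "w \<in> gwords (gens m) \<Longrightarrow> length w \<le> N \<Longrightarrow>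
    \<exists>v\<in>carrier_vec m. \<exists>M. M \<le> N + length w \<and> N \<le> M + length w \<and>
      (\<forall>i<m. \<bar>v $ i\<bar> \<le> int (length w) * \<beta>) \<and>
      t [^]\<^bsub>\<GG>\<^esub> N \<otimes>\<^bsub>\<GG>\<^esub> cls w = avec v \<otimes>\<^bsub>\<GG>\<^esub> t [^]\<^bsub>\<GG>\<^esub> M"
proof (induction w rule: rev_induct)
  case Nil
  then show ?case
    using t_closed by (intro bexI[of _ "0\<^sub>v m"] exI[of _ N]) (auto simp: cls_Nil avec_zero)
next
  case (snoc l w)
  obtain x e where l: "l = (x, e)" by (cases l)
  have w: "w \<in> gwords (gens m)" and x: "x \<in> gens m" and lw: "[l] \<in> gwords (gens m)"
    and len: "length w < N"
    using snoc.prems l by auto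
  obtain v M where v: "v \<in> carrier_vec m" and M: "M \<le> N + length w" "N \<le> M + length w"
    and vb: "\<And>i. i < m \<Longrightarrow> \<bar>v $ i\<bar> \<le> int (length w) * \<beta>"
    and eq: "t [^]\<^bsub>\<GG>\<^esub> N \<otimes>\<^bsub>\<GG>\<^esub> cls w = avec v \<otimes>\<^bsub>\<GG>\<^esub> t [^]\<^bsub>\<GG>\<^esub> M"
    using snoc.IH[OF w] len by auto
  have c: "cls w \<in> carrier \<GG>" "cls [l] \<in> carrier \<GG>" "\<And>n :: nat. t [^]\<^bsub>\<GG>\<^esub> n \<in> carrier \<GG>"
    "avec v \<in> carrier \<GG>"
    using cls_closed[OF w] cls_closed[OF lw] t_closed avec_closed by auto
  have step: "t [^]\<^bsub>\<GG>\<^esub> N \<otimes>\<^bsub>\<GG>\<^esub> cls (w @ [l]) = avec v \<otimes>\<^bsub>\<GG>\<^esub> (t [^]\<^bsub>\<GG>\<^esub> M \<otimes>\<^bsub>\<GG>\<^esub> cls [l])"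
    unfolding cls_append[OF w lw] using eq c by (metis m_assoc)
  show ?case
  proof (cases x)
    case (GenA i)
    have i: "i < m" using x GenA by (auto simp: gens_def)
    let ?u = "(if e then 1 else -1) \<cdot>\<^sub>v unit_vec m i :: int vec"
    let ?v = "(T ^\<^sub>m M) *\<^sub>v ?u"
    have u: "?u \<in> carrier_vec m" by simp
    have v': "?v \<in> carrier_vec m" by (rule mat_pow_mult_vec_carrier[OF u])
    have "cls [l] = avec ?u" using cls_letter[OF x, of e] avec_unit[OF i] l GenA by simp
    then have "t [^]\<^bsub>\<GG>\<^esub> N \<otimes>\<^bsub>\<GG>\<^esub> cls (w @ [l]) = avec v \<otimes>\<^bsub>\<GG>\<^esub> (avec ?v \<otimes>\<^bsub>\<GG>\<^esub> t [^]\<^bsub>\<GG>\<^esub> M)"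
      using step t_pow_avec[OF u] by simp
    also have "\<dots> = avec (v + ?v) \<otimes>\<^bsub>\<GG>\<^esub> t [^]\<^bsub>\<GG>\<^esub> M"
      using avec_add[OF v v'] m_assoc[OF c(4) avec_closed c(3)] by simp
    finally have eq': "t [^]\<^bsub>\<GG>\<^esub> N \<otimes>\<^bsub>\<GG>\<^esub> cls (w @ [l]) = avec (v + ?v) \<otimes>\<^bsub>\<GG>\<^esub> t [^]\<^bsub>\<GG>\<^esub> M" .
    have "\<bar>(v + ?v) $ p\<bar> \<le> int (length (w @ [l])) * \<beta>" if p: "p < m" for p
    proof -
      have P: "T ^\<^sub>m M \<in> carrier_mat m m" by (rule pow_carrier_mat[OF T])
      have "?v $ p = (if e then 1 else -1) * (T ^\<^sub>m M) $$ (p, i)"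
        using carrier_matD[OF P] p i by (simp add: scalar_prod_right_unit)
      then have "\<bar>?v $ p\<bar> \<le> \<beta>" using \<beta>[rule_format, of M p i] M(1) len p i by auto
      moreover have "(v + ?v) $ p = v $ p + ?v $ p" using v' p by (intro index_add_vec(1)) (metis carrier_vecD)
      moreover have "int (length (w @ [l])) * \<beta> = int (length w) * \<beta> + \<beta>" by (simp add: algebra_simps)
      ultimately show ?thesis using vb[OF p] by linarith
    qed
    then show ?thesis using v v' M eq' by (intro bexI[of _ "v + ?v"] exI[of _ M]) auto
  next
    case GenT
    have b0: "0 \<le> \<beta>" if "p < m" for p using \<beta>[rule_format, of 0 p p] that by linarith
    have vb': "\<bar>v $ p\<bar> \<le> int (length (w @ [l])) * \<beta>" if "p < m" for p
      using vb[OF that] b0[OF that] by (simp add: algebra_simps)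
    show ?thesis
    proof (cases e)
      case True
      have "cls [l] = t" using cls_letter[OF x, of e] l GenT True t_closed by simp
      then have "t [^]\<^bsub>\<GG>\<^esub> N \<otimes>\<^bsub>\<GG>\<^esub> cls (w @ [l]) = avec v \<otimes>\<^bsub>\<GG>\<^esub> t [^]\<^bsub>\<GG>\<^esub> Suc M"
        using step by simp
      then show ?thesis using v M vb' by (intro bexI[of _ v] exI[of _ "Suc M"]) auto
    next
      case False
      have li: "cls [l] = inv\<^bsub>\<GG>\<^esub> t"
        using cls_letter[OF x, of e] l GenT False t_closed by (simp add: int_pow_neg)
      obtain M' where M': "M = Suc M'" using M(2) len by (cases M) auto
      have "t [^]\<^bsub>\<GG>\<^esub> M \<otimes>\<^bsub>\<GG>\<^esub> cls [l] = t [^]\<^bsub>\<GG>\<^esub> M'"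
        unfolding M' li using c t_closed by (simp add: m_assoc)
      then have "t [^]\<^bsub>\<GG>\<^esub> N \<otimes>\<^bsub>\<GG>\<^esub> cls (w @ [l]) = avec v \<otimes>\<^bsub>\<GG>\<^esub> t [^]\<^bsub>\<GG>\<^esub> M'"
        using step by simp
      then show ?thesis using v M vb' M' by (intro bexI[of _ v] exI[of _ M']) auto
    qed
  qed
qed

lemma mat_pow_entries_bounded:
  "\<exists>\<beta>. \<forall>j p q. j \<le> k \<longrightarrow> p < m \<longrightarrow> q < m \<longrightarrow> \<bar>(T ^\<^sub>m j) $$ (p, q)\<bar> \<le> \<beta>"
proof -
  let ?S = "(\<lambda>(j, p, q). \<bar>(T ^\<^sub>m j) $$ (p, q)\<bar>) ` ({..k} \<times> {..<m} \<times> {..<m})"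
  have "\<bar>(T ^\<^sub>m j) $$ (p, q)\<bar> \<le> Max ?S" if "j \<le> k" "p < m" "q < m" for j p q
    using that by (intro Max_ge) force+
  then show ?thesis by blast
qed

lemma carrier_cases:
  assumes "x \<in> carrier \<GG>"
  obtains w where "w \<in> gwords (gens m)" "cls w = x"
  using assms that by (auto simp: GmT_def carrier_presented_group)

lemma elliptic_normal_form:
  assumes w: "w \<in> gwords (gens m)" "length w \<le> N" and 0: "tau m T (cls w) = 0"
  shows "\<exists>v\<in>carrier_vec m. t [^]\<^bsub>\<GG>\<^esub> N \<otimes>\<^bsub>\<GG>\<^esub> cls w = avec v \<otimes>\<^bsub>\<GG>\<^esub> t [^]\<^bsub>\<GG>\<^esub> N"
proof -
  obtain \<beta> where \<beta>: "\<forall>j p q. j \<le> 2 * N \<longrightarrow> p < m \<longrightarrow> q < m \<longrightarrow> \<bar>(T ^\<^sub>m j) $$ (p, q)\<bar> \<le> \<beta>"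
    using mat_pow_entries_bounded[of "2 * N"] by blast
  obtain v and M :: nat where v: "v \<in> carrier_vec m"
      "t [^]\<^bsub>\<GG>\<^esub> N \<otimes>\<^bsub>\<GG>\<^esub> cls w = avec v \<otimes>\<^bsub>\<GG>\<^esub> t [^]\<^bsub>\<GG>\<^esub> M"
    using word_normal_form[OF \<beta> w] by (elim bexE exE conjE)
  have "tau m T (t [^]\<^bsub>\<GG>\<^esub> n) = int n" for n :: nat
    using tau_nat_pow[OF t_closed, of n] tau_hom[of m T] by simp
  then have "int N = int M"
    using arg_cong[OF v(2), of "tau m T"] 0 cls_closed[OF w(1)] avec_closed t_closed
    by (simp add: tau_mult tau_avec)
  then show ?thesis using v by auto
qed

text \<open>Conjugation by a common power of \<open>t\<close> moves both elements into the lattice.\<close>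
lemma elliptic_commute:
  assumes x: "x \<in> carrier \<GG>" "tau m T x = 0" and y: "y \<in> carrier \<GG>" "tau m T y = 0"
  shows "x \<otimes>\<^bsub>\<GG>\<^esub> y = y \<otimes>\<^bsub>\<GG>\<^esub> x"
proof -
  obtain wx where wx: "wx \<in> gwords (gens m)" "cls wx = x" using carrier_cases[OF x(1)] .
  obtain wy where wy: "wy \<in> gwords (gens m)" "cls wy = y" using carrier_cases[OF y(1)] .
  define N where "N = max (length wx) (length wy)"
  define s where "s = t [^]\<^bsub>\<GG>\<^esub> N"
  have s: "s \<in> carrier \<GG>" using t_closed by (simp add: s_def)
  obtain u where u: "u \<in> carrier_vec m" "s \<otimes>\<^bsub>\<GG>\<^esub> x = avec u \<otimes>\<^bsub>\<GG>\<^esub> s"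
    using elliptic_normal_form[OF wx(1), of N] wx(2) x(2) by (auto simp: N_def s_def)
  obtain v where v: "v \<in> carrier_vec m" "s \<otimes>\<^bsub>\<GG>\<^esub> y = avec v \<otimes>\<^bsub>\<GG>\<^esub> s"
    using elliptic_normal_form[OF wy(1), of N] wy(2) y(2) by (auto simp: N_def s_def)
  have *: "s \<otimes>\<^bsub>\<GG>\<^esub> (g \<otimes>\<^bsub>\<GG>\<^esub> h) = avec p \<otimes>\<^bsub>\<GG>\<^esub> avec q \<otimes>\<^bsub>\<GG>\<^esub> s"
    if "g \<in> carrier \<GG>" "h \<in> carrier \<GG>" "s \<otimes>\<^bsub>\<GG>\<^esub> g = avec p \<otimes>\<^bsub>\<GG>\<^esub> s" "s \<otimes>\<^bsub>\<GG>\<^esub> h = avec q \<otimes>\<^bsub>\<GG>\<^esub> s"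
    for g h p q
  proof -
    have "s \<otimes>\<^bsub>\<GG>\<^esub> (g \<otimes>\<^bsub>\<GG>\<^esub> h) = avec p \<otimes>\<^bsub>\<GG>\<^esub> s \<otimes>\<^bsub>\<GG>\<^esub> h" using m_assoc[OF s that(1,2)] that(3) by simp
    also have "\<dots> = avec p \<otimes>\<^bsub>\<GG>\<^esub> (avec q \<otimes>\<^bsub>\<GG>\<^esub> s)" using m_assoc[OF avec_closed s that(2)] that(4) by simp
    finally show ?thesis using m_assoc[OF avec_closed avec_closed s] by simp
  qed
  have "s \<otimes>\<^bsub>\<GG>\<^esub> (x \<otimes>\<^bsub>\<GG>\<^esub> y) = s \<otimes>\<^bsub>\<GG>\<^esub> (y \<otimes>\<^bsub>\<GG>\<^esub> x)"
    using *[OF x(1) y(1) u(2) v(2)] *[OF y(1) x(1) v(2) u(2)] avec_commute[OF u(1) v(1)] by simp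
  then show ?thesis using s x(1) y(1) by simp
qed

lemma word_length_comparison:
  assumes Y: "finite_generating_set \<GG> Y"
  obtains L where "\<And>g. g \<in> carrier \<GG> \<Longrightarrow>
    \<exists>w\<in>gwords (gens m). cls w = g \<and> length w \<le> L * word_length \<GG> Y g"
proof -
  interpret F: fin_gen_group \<GG> Y by unfold_locales (rule Y)
  have "\<forall>y\<in>F.letters. \<exists>w\<in>gwords (gens m). cls w = y"
    using F.letters_carrier carrier_cases by blast
  then obtain W where W: "\<And>y. y \<in> F.letters \<Longrightarrow> W y \<in> gwords (gens m) \<and> cls (W y) = y" by metis
  define L where "L = Max ((length \<circ> W) ` F.letters)"
  have L: "length (W y) \<le> L" if "y \<in> F.letters" for y
    unfolding L_def using that F.finite_letters by (intro Max_ge) (auto simp: image_iff)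
  have ex: "set ys \<subseteq> F.letters \<Longrightarrow> \<exists>w\<in>gwords (gens m). cls w = F.word_prod ys \<and> length w \<le> L * length ys" for ys
  proof (induction ys)
    case Nil
    then show ?case by (intro bexI[of _ "[]"]) (auto simp: cls_Nil)
  next
    case (Cons y ys)
    then obtain w where w: "w \<in> gwords (gens m)" "cls w = F.word_prod ys" "length w \<le> L * length ys" by auto
    have y: "y \<in> F.letters" using Cons.prems by auto
    have "cls (W y @ w) = F.word_prod (y # ys)" using W[OF y] w cls_append by simp
    moreover have "length (W y @ w) \<le> L * length (y # ys)" using L[OF y] w(3) by simp
    ultimately show ?case using W[OF y] w(1) by (intro bexI[of _ "W y @ w"]) auto
  qed
  show ?thesis
  proof (rule that[of L])
    fix g assume "g \<in> carrier \<GG>"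
    from F.geodesic_word[OF this] obtain ys
      where "set ys \<subseteq> F.letters" "F.word_prod ys = g" "length ys = word_length \<GG> Y g" .
    then show "\<exists>w\<in>gwords (gens m). cls w = g \<and> length w \<le> L * word_length \<GG> Y g"
      using ex[of ys] by metis
  qed
qed

lemma card_bounded_int_vecs:
  shows "finite {v \<in> carrier_vec m. \<forall>i<m. \<bar>v $ i\<bar> \<le> int b}"
    and "card {v \<in> carrier_vec m. \<forall>i<m. \<bar>v $ i\<bar> \<le> int b} \<le> (2 * b + 1) ^ m"
proof -
  let ?V = "{v \<in> carrier_vec m. \<forall>i<m. \<bar>v $ i\<bar> \<le> int b}" and ?P = "PiE {..<m} (\<lambda>_. {- int b..int b})"
  let ?f = "\<lambda>v. restrict (\<lambda>i. v $ i) {..<m}"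
  have inj: "inj_on ?f ?V"
  proof (rule inj_onI)
    fix u v assume *: "u \<in> ?V" "v \<in> ?V" "?f u = ?f v"
    have "u $ i = v $ i" if "i < m" for i using fun_cong[OF *(3), of i] that by simp
    then show "u = v" using *(1,2) by (intro eq_vecI) auto
  qed
  have sub: "?f ` ?V \<subseteq> ?P"
  proof
    fix f assume "f \<in> ?f ` ?V"
    then obtain v where v: "v \<in> ?V" "f = ?f v" by blast
    have "f i \<in> {- int b..int b}" if "i < m" for i
    proof -
      have "\<bar>v $ i\<bar> \<le> int b" using v(1) that by simp
      then show ?thesis using v(2) that by (simp add: abs_le_iff)
    qed
    then show "f \<in> ?P" using v(2) by (intro PiE_I) auto
  qed
  have fin: "finite ?P" by (intro finite_PiE) auto
  show "finite ?V" using inj sub fin by (meson finite_imageD finite_subset)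
  have "card ?V \<le> card ?P" by (rule card_inj_on_le[OF inj sub fin])
  also have "\<dots> = (2 * b + 1) ^ m" by (simp add: card_PiE nat_add_distrib nat_mult_distrib)
  finally show "card ?V \<le> (2 * b + 1) ^ m" .
qed

text \<open>By the normal form, an element of length at most \<open>n\<close> is determined by an exponent and an integer vector,
  both of size polynomial in \<open>n\<close>.\<close>
lemma polynomial_growth:
  assumes C: "\<forall>j p q. p < m \<longrightarrow> q < m \<longrightarrow> \<bar>(T ^\<^sub>m j) $$ (p, q)\<bar> \<le> int (C * (j + 1) ^ d)"
    and Y: "finite_generating_set \<GG> Y"
  obtains C' D :: nat where "\<And>n. card (word_ball \<GG> Y n) \<le> C' * (n + 1) ^ D"
proof -
  obtain L where L: "\<And>g. g \<in> carrier \<GG> \<Longrightarrow>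
      \<exists>w\<in>gwords (gens m). cls w = g \<and> length w \<le> L * word_length \<GG> Y g"
    using word_length_comparison[OF Y] by blast
  define D where "D = 1 + (d + 1) * m"
  define C' where "C' = (2 * C + 1) ^ m * (2 * L + 1) ^ D"
  have "card (word_ball \<GG> Y n) \<le> C' * (n + 1) ^ D" for n
  proof -
    define N where "N = L * n"
    define b where "b = N * (C * (2 * N + 1) ^ d)"
    define X where "X = 2 * N + 1"
    let ?V = "{v \<in> carrier_vec m. \<forall>i<m. \<bar>v $ i\<bar> \<le> int b}"
    let ?f = "\<lambda>(v, M). inv\<^bsub>\<GG>\<^esub> (t [^]\<^bsub>\<GG>\<^esub> N) \<otimes>\<^bsub>\<GG>\<^esub> (avec v \<otimes>\<^bsub>\<GG>\<^esub> t [^]\<^bsub>\<GG>\<^esub> (M :: nat))"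
    have fin: "finite (?V \<times> {..2 * N})" using card_bounded_int_vecs(1) by simp
    have "word_ball \<GG> Y n \<subseteq> ?f ` (?V \<times> {..2 * N})"
    proof
      fix g assume "g \<in> word_ball \<GG> Y n"
      then have g: "g \<in> carrier \<GG>" "word_length \<GG> Y g \<le> n" by (simp_all add: word_ball_def)
      obtain w where w: "w \<in> gwords (gens m)" "cls w = g" "length w \<le> L * word_length \<GG> Y g"
        using L[OF g(1)] by blast
      have wN: "length w \<le> N" using w(3) g(2) unfolding N_def by (meson mult_le_mono2 order_trans)
      have \<beta>: "\<forall>j p q. j \<le> 2 * N \<longrightarrow> p < m \<longrightarrow> q < m \<longrightarrow>
          \<bar>(T ^\<^sub>m j) $$ (p, q)\<bar> \<le> int (C * (2 * N + 1) ^ d)"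
      proof (intro allI impI)
        fix j p q assume that: "j \<le> 2 * N" "p < m" "q < m"
        have "C * (j + 1) ^ d \<le> C * (2 * N + 1) ^ d"
          using that(1) by (intro mult_le_mono2 power_mono) auto
        then have "int (C * (j + 1) ^ d) \<le> int (C * (2 * N + 1) ^ d)" by (rule of_nat_mono)
        then show "\<bar>(T ^\<^sub>m j) $$ (p, q)\<bar> \<le> int (C * (2 * N + 1) ^ d)"
          using C[rule_format, OF that(2,3), of j] by linarith
      qed
      obtain v M where v: "v \<in> carrier_vec m" "M \<le> N + length w"
        "\<And>i. i < m \<Longrightarrow> \<bar>v $ i\<bar> \<le> int (length w) * int (C * (2 * N + 1) ^ d)"
        "t [^]\<^bsub>\<GG>\<^esub> N \<otimes>\<^bsub>\<GG>\<^esub> cls w = avec v \<otimes>\<^bsub>\<GG>\<^esub> t [^]\<^bsub>\<GG>\<^esub> M"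
        using word_normal_form[OF \<beta> w(1) wN] by blast
      have "int (length w) * int (C * (2 * N + 1) ^ d) \<le> int b"
        unfolding b_def of_nat_mult[symmetric] using wN by (intro of_nat_mono mult_le_mono1)
      then have "v \<in> ?V" using v(1,3) by fastforce
      moreover have "M \<le> 2 * N" using v(2) wN by simp
      moreover have "g = ?f (v, M)"
        using v(4) g(1) w(2) t_closed inv_solve_left[of g "t [^]\<^bsub>\<GG>\<^esub> N" "avec v \<otimes>\<^bsub>\<GG>\<^esub> t [^]\<^bsub>\<GG>\<^esub> M"]
          avec_closed by simp
      ultimately show "g \<in> ?f ` (?V \<times> {..2 * N})" by blast
    qed
    then have "card (word_ball \<GG> Y n) \<le> card (?V \<times> {..2 * N})"
      using fin by (rule surj_card_le[rotated])
    also have "\<dots> = card ?V * X" by (simp add: card_cartesian_product X_def)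
    also have "\<dots> \<le> (2 * b + 1) ^ m * X" by (intro mult_le_mono1 card_bounded_int_vecs(2))
    also have "\<dots> \<le> ((2 * C + 1) * X ^ (d + 1)) ^ m * X"
    proof (intro mult_le_mono1 power_mono)
      have "b \<le> X * (C * X ^ d)" unfolding b_def X_def by (intro mult_le_mono1) simp
      then have "2 * b + 1 \<le> 2 * (X * (C * X ^ d)) + 1" by simp
      also have "\<dots> \<le> 2 * (X * (C * X ^ d)) + X ^ (d + 1)"
        using one_le_power[of X "d + 1"] by (simp only: X_def add_left_mono le_add2)
      also have "\<dots> = (2 * C + 1) * X ^ (d + 1)" by (simp add: algebra_simps)
      finally show "2 * b + 1 \<le> (2 * C + 1) * X ^ (d + 1)" .
    qed simp
    also have "\<dots> = (2 * C + 1) ^ m * X ^ D"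
    proof -
      have "((2 * C + 1) * X ^ (d + 1)) ^ m = (2 * C + 1) ^ m * X ^ ((d + 1) * m)"
        by (simp only: power_mult_distrib power_mult)
      moreover have "X ^ D = X * X ^ ((d + 1) * m)" by (simp only: D_def power_add power_one_right)
      ultimately show ?thesis by (simp only: mult_ac)
    qed
    also have "\<dots> \<le> (2 * C + 1) ^ m * ((2 * L + 1) * (n + 1)) ^ D"
      by (intro mult_le_mono2 power_mono) (simp_all add: X_def N_def)
    also have "\<dots> = C' * (n + 1) ^ D"
      unfolding C'_def power_mult_distrib by (simp only: mult.assoc)
    finally show ?thesis .
  qed
  then show ?thesis by (rule that)
qed

end

section \<open>Exponential growth forces an expanding eigenvalue\<close>
lemma polynomial_bound_liminf_root:
  fixes b :: "nat \<Rightarrow> nat"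
  assumes b: "\<And>n. b n \<le> C * (n + 1) ^ D"
  shows "liminf (\<lambda>n. ereal (root n (real (b n)))) \<le> 1"
proof -
  let ?c = "real (C + 1) * 2 ^ D"
  have "(\<lambda>n. root n ?c * root n (real n) ^ D) \<longlonglongrightarrow> 1 * 1 ^ D"
    by (intro tendsto_intros LIMSEQ_root LIMSEQ_root_const) simp
  then have lim: "(\<lambda>n. ereal (root n ?c * root n (real n) ^ D)) \<longlonglongrightarrow> ereal 1" by simp
  have "eventually (\<lambda>n. ereal (root n (real (b n))) \<le> ereal (root n ?c * root n (real n) ^ D)) sequentially"
    using eventually_gt_at_top[of 0]
  proof eventually_elim
    case (elim n)
    have "real (b n) \<le> real (C * (n + 1) ^ D)" using b by (intro of_nat_mono)
    also have "\<dots> \<le> real ((C + 1) * (2 * n) ^ D)"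
      using elim by (intro of_nat_mono mult_le_mono power_mono) auto
    also have "\<dots> = ?c * real n ^ D" by (simp add: power_mult_distrib algebra_simps)
    finally have "root n (real (b n)) \<le> root n (?c * real n ^ D)" using elim by simp
    also have "\<dots> = root n ?c * root n (real n) ^ D"
      using elim by (simp only: real_root_mult real_root_power)
    finally show ?case by simp
  qed
  then have "liminf (\<lambda>n. ereal (root n (real (b n)))) \<le>
      liminf (\<lambda>n. ereal (root n ?c * root n (real n) ^ D))" by (rule Liminf_mono)
  also have "\<dots> = 1" using lim_imp_Liminf[OF _ lim] by simp
  finally show ?thesis .
qed

lemma lacunary_sum_inj:
  fixes \<mu> :: complex
  assumes \<mu>: "2 \<le> norm \<mu>"
  shows "J \<subseteq> {..<N} \<Longrightarrow> J' \<subseteq> {..<N} \<Longrightarrow>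
    (\<Sum>j<N. of_bool (j \<in> J) * \<mu> ^ j) = (\<Sum>j<N. of_bool (j \<in> J') * \<mu> ^ j) \<Longrightarrow> J = J'"
proof (induction N arbitrary: J J')
  case 0
  then show ?case by simp
next
  case (Suc N)
  let ?s = "\<lambda>J. \<Sum>j<N. of_bool (j \<in> J) * \<mu> ^ j"
  \<comment> \<open>The top term cannot be balanced by the lower ones.\<close>
  have dom: "norm (?s K - ?s K') < norm \<mu> ^ N" for K K'
  proof -
    have "?s K - ?s K' = (\<Sum>j<N. (of_bool (j \<in> K) - of_bool (j \<in> K')) * \<mu> ^ j)"
      by (simp add: sum_subtractf algebra_simps)
    also have "norm \<dots> \<le> (\<Sum>j<N. norm \<mu> ^ j)"
      by (rule sum_norm_le) (simp add: norm_mult norm_power)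
    also have "(\<Sum>j<N. norm \<mu> ^ j) < norm \<mu> ^ N"
    proof (induction N)
      case (Suc N)
      have "(\<Sum>j<Suc N. norm \<mu> ^ j) < norm \<mu> ^ N + norm \<mu> ^ N" using Suc by simp
      also have "\<dots> \<le> norm \<mu> ^ Suc N" using \<mu> mult_right_mono[OF \<mu>, of "norm \<mu> ^ N"] by simp
      finally show ?case .
    qed simp
    finally show ?thesis .
  qed
  have eq: "?s J + of_bool (N \<in> J) * \<mu> ^ N = ?s J' + of_bool (N \<in> J') * \<mu> ^ N"
    using Suc.prems(3) by simp
  have "N \<in> J \<longleftrightarrow> N \<in> J'"
  proof (rule ccontr)
    assume "\<not> (N \<in> J \<longleftrightarrow> N \<in> J')"
    then have "?s J' - ?s J = \<mu> ^ N \<or> ?s J - ?s J' = \<mu> ^ N"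
      using eq by (auto simp: algebra_simps)
    then show False using dom[of J' J] dom[of J J'] by (auto simp: norm_power)
  qed
  have s: "?s (K - {N}) = ?s K" for K by (intro sum.cong) auto
  have "J - {N} = J' - {N}"
  proof (rule Suc.IH)
    show "J - {N} \<subseteq> {..<N}" "J' - {N} \<subseteq> {..<N}" using Suc.prems(1,2) by (auto simp: less_Suc_eq)
    show "?s (J - {N}) = ?s (J' - {N})" unfolding s using eq \<open>N \<in> J \<longleftrightarrow> N \<in> J'\<close> by simp
  qed
  then show ?case using \<open>N \<in> J \<longleftrightarrow> N \<in> J'\<close> by blast
qed

text \<open>The affine maps \<open>x \<mapsto> c x + z\<close> of the complex line, written \<open>(c, z)\<close>.\<close>

definition affine_group :: "(complex \<times> complex) monoid" where
  "affine_group = \<lparr>carrier = {(c, z). c \<noteq> 0}, monoid.mult = (\<lambda>(c, z) (d, w). (c * d, z + c * w)), one = (1, 0)\<rparr>"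

lemma affine_simps [simp]:
  "(c, z) \<in> carrier affine_group \<longleftrightarrow> c \<noteq> 0"
  "(c, z) \<otimes>\<^bsub>affine_group\<^esub> (d, w) = (c * d, z + c * w)"
  "\<one>\<^bsub>affine_group\<^esub> = (1, 0)"
  by (auto simp: affine_group_def)

lemma group_affine_group: "Group.group affine_group"
proof (rule groupI)
  fix x assume "x \<in> carrier affine_group"
  then show "\<exists>y\<in>carrier affine_group. y \<otimes>\<^bsub>affine_group\<^esub> x = \<one>\<^bsub>affine_group\<^esub>"
    by (cases x) (auto intro!: bexI[of _ "(1 / fst x, - snd x / fst x)"])
qed (auto simp: affine_group_def algebra_simps)

lemma affine_inv: "c \<noteq> 0 \<Longrightarrow> inv\<^bsub>affine_group\<^esub> (c, z) = (1 / c, - z / c)"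
  by (rule group.inv_equality[OF group_affine_group]) auto

context lattice_hnn
begin

text \<open>A nonzero eigenvalue of \<open>T\<close> makes the group act on the complex line: \<open>t\<close> by scaling,
  the lattice by translations along the linear functional given by a left eigenvector.\<close>

lemma affine_action:
  fixes \<mu> :: complex
  assumes v: "v \<in> carrier_vec m" "transpose_mat (map_mat of_int T) *\<^sub>v v = \<mu> \<cdot>\<^sub>v v" and \<mu>: "\<mu> \<noteq> 0"
  obtains h where "h \<in> hom \<GG> affine_group" "h t = (\<mu>, 0)" "\<And>i. i < m \<Longrightarrow> h (a i) = (1, v $ i)"
proof -
  interpret F: Group.group affine_group by (rule group_affine_group)
  define f where "f x = (case x of GenA i \<Rightarrow> (1, v $ i) | GenT \<Rightarrow> (\<mu>, 0))" for x
  let ?ev = "eval_gword affine_group f"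
  have f: "f ` gens m \<subseteq> carrier affine_group" using \<mu> by (auto simp: f_def gens_def)
  have fg: "f (GenA i) = (1, v $ i)" "f GenT = (\<mu>, 0)" for i by (simp_all add: f_def)
  have ev: "?ev [] = (1, 0)"
    "?ev (l # w) = (if snd l then f (fst l) else inv\<^bsub>affine_group\<^esub> f (fst l)) \<otimes>\<^bsub>affine_group\<^esub> ?ev w" for l w
    by (simp_all add: eval_gword_def)
  have rep: "?ev (replicate n (GenA i, e) @ w) = (1, (if e then of_nat n else - of_nat n) * v $ i) \<otimes>\<^bsub>affine_group\<^esub> ?ev w"
    for n i e w
  proof -
    obtain p q where w: "?ev w = (p, q)" by (cases "?ev w")
    show ?thesis by (induction n) (auto simp: ev fg w affine_inv algebra_simps)
  qed
  have pow: "?ev (pow_word (GenA i) k @ w) = (1, of_int k * v $ i) \<otimes>\<^bsub>affine_group\<^esub> ?ev w" for i k w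
    by (simp add: pow_word_def rep)
  have vec': "?ev (concat (map (\<lambda>i. pow_word (GenA i) (u $ i)) xs) @ w) =
      (1, \<Sum>i\<leftarrow>xs. of_int (u $ i) * v $ i) \<otimes>\<^bsub>affine_group\<^esub> ?ev w" for u xs w
  proof -
    obtain p q where w: "?ev w = (p, q)" by (cases "?ev w")
    show ?thesis by (induction xs) (auto simp: pow w add.assoc)
  qed
  have vec: "?ev (vec_word m u @ w) = (1, v \<bullet> map_vec of_int u) \<otimes>\<^bsub>affine_group\<^esub> ?ev w"
    if "u \<in> carrier_vec m" for u w
    unfolding vec_word_def vec' using that
    by (simp add: scalar_prod_def sum_list_distinct_conv_sum_set atLeast0LessThan mult.commute)
  have eig: "v \<bullet> map_vec of_int (T *\<^sub>v u) = \<mu> * (v \<bullet> map_vec of_int u)" if u: "u \<in> carrier_vec m" for u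
  proof -
    let ?Tc = "map_mat of_int T :: complex mat" and ?u = "map_vec of_int u :: complex vec"
    have Tc: "?Tc \<in> carrier_mat m m" using T by simp
    have uc: "?u \<in> carrier_vec m" using u by simp
    have "map_vec of_int (T *\<^sub>v u) = ?Tc *\<^sub>v ?u" by (rule of_int_hom.mult_mat_vec_hom[OF T u])
    then have "v \<bullet> map_vec of_int (T *\<^sub>v u) = (transpose_mat ?Tc *\<^sub>v v) \<bullet> ?u"
      using transpose_vec_mult_scalar[OF Tc uc v(1)] by simp
    also have "\<dots> = \<mu> * (v \<bullet> ?u)" unfolding v(2) using v(1) uc by simp
    finally show ?thesis .
  qed
  have R: "?ev x = ?ev y" if "(x, y) \<in> rels m T" for x y
  proof -
    have Tu: "T *\<^sub>v u \<in> carrier_vec m" if "u \<in> carrier_vec m" for u :: "int vec"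
      using T that mult_mat_vec_carrier by blast
    show ?thesis
      using that unfolding rels_def
    proof (elim UnE CollectE exE conjE)
      fix i j assume "(x, y) = ([(GenA i, True), (GenA j, True)], [(GenA j, True), (GenA i, True)])"
      then show ?thesis by (simp add: ev fg)
    next
      fix u assume xy: "(x, y) = ([(GenT, True)] @ vec_word m u @ [(GenT, False)], vec_word m (T *\<^sub>v u))"
        and u: "u \<in> carrier_vec m"
      have "?ev x = (\<mu>, 0) \<otimes>\<^bsub>affine_group\<^esub> ((1, v \<bullet> map_vec of_int u) \<otimes>\<^bsub>affine_group\<^esub> (1 / \<mu>, 0))"
        using xy u \<mu> by (simp add: ev vec fg affine_inv)
      also have "\<dots> = (1, v \<bullet> map_vec of_int (T *\<^sub>v u))" using \<mu> eig[OF u] by simp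
      also have "\<dots> = ?ev y" using xy vec[OF Tu[OF u], of "[]"] by (simp add: ev)
      finally show ?thesis .
    qed
  qed
  obtain h where h: "h \<in> hom \<GG> affine_group"
      "\<And>x. x \<in> gens m \<Longrightarrow> h (pres_gen (gens m) (rels m T) x) = f x"
    using presented_group_universal[OF group_affine_group f, of "rels m T"] R by (auto simp: GmT_def)
  show ?thesis
    using h by (intro that[of h]) (auto simp: gens_def gen_a_def gen_t_def f_def)
qed

lemma spectral_radius_le_1_entries:
  assumes "spectral_radius (map_mat of_int T) \<le> 1"
  obtains C d where "\<forall>j p q. p < m \<longrightarrow> q < m \<longrightarrow> \<bar>(T ^\<^sub>m j) $$ (p, q)\<bar> \<le> int (C * (j + 1) ^ d)"
proof -
  let ?Tc = "map_mat of_int T :: complex mat"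
  have Tc: "?Tc \<in> carrier_mat m m" using T by simp
  have ne: "char_poly ?Tc \<noteq> 0" using degree_monic_char_poly[OF Tc] by auto
  obtain c1 c2 where nb: "\<And>k. norm_bound (?Tc ^\<^sub>m k) (c1 + c2 * of_nat k ^ (degree (char_poly ?Tc) - 1))"
    using spectral_radius_poly_bound[OF Tc assms, of "degree (char_poly ?Tc)"] order_degree[OF ne] by blast
  define d where "d = degree (char_poly ?Tc) - 1"
  obtain C :: nat where C: "\<bar>c1\<bar> + \<bar>c2\<bar> \<le> real C" using real_arch_simple by blast
  have "\<bar>(T ^\<^sub>m j) $$ (p, q)\<bar> \<le> int (C * (j + 1) ^ d)" if "p < m" "q < m" for j p q
  proof -
    have P: "T ^\<^sub>m j \<in> carrier_mat m m" by (rule pow_carrier_mat[OF T])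
    have "(?Tc ^\<^sub>m j) $$ (p, q) = of_int ((T ^\<^sub>m j) $$ (p, q))"
      unfolding of_int_hom.mat_hom_pow[OF T, symmetric] using carrier_matD[OF P] that by simp
    moreover have "norm ((?Tc ^\<^sub>m j) $$ (p, q)) \<le> c1 + c2 * real j ^ d"
      using nb[of j] carrier_matD[OF pow_carrier_mat[OF Tc, of j]] that
      unfolding norm_bound_def d_def by metis
    ultimately have "real_of_int \<bar>(T ^\<^sub>m j) $$ (p, q)\<bar> \<le> c1 + c2 * real j ^ d" by simp
    also have "\<dots> \<le> \<bar>c1\<bar> * real (j + 1) ^ d + \<bar>c2\<bar> * real (j + 1) ^ d"
    proof (intro add_mono mult_mono power_mono)
      have "\<bar>c1\<bar> * 1 \<le> \<bar>c1\<bar> * real (j + 1) ^ d" by (intro mult_left_mono one_le_power) auto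
      then show "c1 \<le> \<bar>c1\<bar> * real (j + 1) ^ d" by linarith
    qed auto
    also have "\<dots> \<le> real C * real (j + 1) ^ d"
      using C by (simp only: distrib_right[symmetric]) (intro mult_right_mono, auto)
    also have "\<dots> = real_of_int (int (C * (j + 1) ^ d))" by simp
    finally show ?thesis by (simp only: of_int_le_iff)
  qed
  then show ?thesis using that by blast
qed

text \<open>A spectral radius of at most \<open>1\<close> would bound the entries of \<open>T ^ j\<close> polynomially and thereby contradict
  exponential growth. The eigenvector is taken for the transpose because a linear functional
  scaled by \<open>T\<close> is needed.\<close>
lemma expanding_eigenvalue:
  assumes "0 < m" "exponential_growth \<GG>"
  obtains \<mu> v where "v \<in> carrier_vec m" "v \<noteq> 0\<^sub>v m" "1 < norm \<mu>"
    "transpose_mat (map_mat of_int T :: complex mat) *\<^sub>v v = \<mu> \<cdot>\<^sub>v v"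
proof -
  let ?Tc = "map_mat of_int T :: complex mat"
  have Tc: "?Tc \<in> carrier_mat m m" using T by simp
  have "1 < spectral_radius ?Tc"
  proof (rule ccontr)
    assume "\<not> 1 < spectral_radius ?Tc"
    then obtain C d where C: "\<forall>j p q. p < m \<longrightarrow> q < m \<longrightarrow> \<bar>(T ^\<^sub>m j) $$ (p, q)\<bar> \<le> int (C * (j + 1) ^ d)"
      using spectral_radius_le_1_entries by (meson not_le)
    obtain Y where Y: "finite_generating_set \<GG> Y"
      "1 < liminf (\<lambda>n. ereal (root n (real (card (word_ball \<GG> Y n)))))"
      using assms(2) by (auto simp: exponential_growth_def)
    obtain C' D where "\<And>n. card (word_ball \<GG> Y n) \<le> C' * (n + 1) ^ D"
      using polynomial_growth[OF C Y(1)] by blast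
    from polynomial_bound_liminf_root[OF this] show False using Y(2) by (simp add: not_less[symmetric])
  qed
  moreover obtain \<mu> where \<mu>: "\<mu> \<in> spectrum ?Tc" "spectral_radius ?Tc = norm \<mu>"
    using spectral_radius_mem_max(1)[OF Tc assms(1)] by auto
  ultimately have "1 < norm \<mu>" by simp
  have "eigenvalue ?Tc \<mu>" using \<mu>(1) by (simp add: spectrum_def)
  then have "eigenvalue (transpose_mat ?Tc) \<mu>"
    using eigenvalue_root_char_poly[OF Tc] eigenvalue_root_char_poly[of "transpose_mat ?Tc" m] Tc by simp
  then obtain v where "eigenvector (transpose_mat ?Tc) v \<mu>" by (auto simp: eigenvalue_def)
  then show ?thesis
    using that[of v \<mu>] \<open>1 < norm \<mu>\<close> Tc by (simp add: eigenvector_def)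
qed

lemma abelian_by_cyclic_GmT: "abelian_by_cyclic \<GG> (tau m T) t"
  by unfold_locales (use tau_mult t_closed tau_hom elliptic_commute in auto)

text \<open>A generator \<open>a i\<close> is chosen on which the functional of a left eigenvector does not vanish. Under the affine
  action, its translates to the heights \<open>k j\<close> become translations by multiples of \<open>(\<mu> ^ k) ^ j\<close>, and
  \<open>k\<close> is taken large enough for these to be lacunary.\<close>
lemma spreading_GmT:
  assumes m: "0 < m" and growth: "exponential_growth \<GG>"
  obtains x \<kappa> where "spreading \<GG> (tau m T) t x \<kappa>"
proof -
  interpret A: abelian_by_cyclic \<GG> "tau m T" t by (rule abelian_by_cyclic_GmT)
  obtain \<mu> v where v: "v \<in> carrier_vec m" "v \<noteq> 0\<^sub>v m" and \<mu>: "1 < norm \<mu>"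
    and eig: "transpose_mat (map_mat of_int T :: complex mat) *\<^sub>v v = \<mu> \<cdot>\<^sub>v v"
    using expanding_eigenvalue[OF m growth] .
  have \<mu>0: "\<mu> \<noteq> 0" using \<mu> by auto
  obtain i where i: "i < m" "v $ i \<noteq> 0"
    using v by (metis eq_vecI carrier_vecD index_zero_vec)
  obtain h where h: "h \<in> hom \<GG> affine_group" "h t = (\<mu>, 0)" "\<And>i. i < m \<Longrightarrow> h (a i) = (1, v $ i)"
    using affine_action[OF v(1) eig \<mu>0] by blast
  interpret h: group_hom \<GG> affine_group h
    by (simp add: group_hom_def group_hom_axioms_def h(1) group_affine_group is_group)
  interpret F: Group.group affine_group by (rule group_affine_group)
  obtain k0 where "2 < norm \<mu> ^ k0" using real_arch_pow[OF \<mu>] by blast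
  moreover define k where "k = Suc k0"
  moreover have "norm \<mu> ^ k0 \<le> norm \<mu> ^ k" using \<mu> by (intro power_increasing) (auto simp: k_def)
  ultimately have k: "2 \<le> norm (\<mu> ^ k)" unfolding norm_power by linarith
  have ai: "a i \<in> A.ker" using a_closed i(1) tau_hom by (simp add: A.ker_def)
  have aff_pow: "(\<mu>, 0) [^]\<^bsub>affine_group\<^esub> n = (\<mu> ^ n, 0)" for n :: nat
    by (induction n) (auto simp: nat_pow_def)
  have h_shift: "h (A.shift (int k * int n) x) = (1, (\<mu> ^ k) ^ n * z)"
    if "x \<in> carrier \<GG>" "h x = (1, z)" for n x z
  proof -
    have "t [^]\<^bsub>\<GG>\<^esub> (int k * int n) = t [^]\<^bsub>\<GG>\<^esub> (k * n)" by (metis int_pow_int of_nat_mult)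
    moreover have "h (t [^]\<^bsub>\<GG>\<^esub> (k * n)) = (\<mu> ^ (k * n), 0)"
      using h.hom_nat_pow[OF t_closed] by (simp add: h(2) aff_pow)
    ultimately show ?thesis
      using that t_closed \<mu>0 by (simp add: A.shift_def affine_inv power_mult)
  qed
  have h_spread: "h (A.spread (a i) (int k) J N) = (1, (\<Sum>j<N. of_bool (j \<in> J) * (\<mu> ^ k) ^ j) * v $ i)" for J N
  proof (induction N)
    case 0
    then show ?case using h.hom_one by simp
  next
    case (Suc N)
    have c: "A.spread (a i) (int k) J N \<in> carrier \<GG>" "A.shift (int k * int N) (a i) \<in> carrier \<GG>"
      using A.spread_ker[OF ai] A.shift_ker[OF ai] A.ker_carrier by blast+
    show ?case
      using c Suc h_shift[OF a_closed[OF i(1)] h(3)[OF i(1)], of N] by (simp add: algebra_simps)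
  qed
  have "spreading \<GG> (tau m T) t (a i) (int k)"
  proof unfold_locales
    show "a i \<in> A.ker" by (rule ai)
    show "1 \<le> int k" by (simp add: k_def)
    fix N
    show "inj_on (\<lambda>J. A.spread (a i) (int k) J N) (Pow {..<N})"
    proof (rule inj_onI)
      fix J J' assume J: "J \<in> Pow {..<N}" "J' \<in> Pow {..<N}"
        "A.spread (a i) (int k) J N = A.spread (a i) (int k) J' N"
      have "(\<Sum>j<N. of_bool (j \<in> J) * (\<mu> ^ k) ^ j) = (\<Sum>j<N. of_bool (j \<in> J') * (\<mu> ^ k) ^ j)"
        using arg_cong[OF J(3), of h] i(2) by (simp add: h_spread)
      then show "J = J'" using lacunary_sum_inj[OF k, of J N J'] J(1,2) by blast
    qed
  qed
  then show ?thesis by (rule that)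
qed

end

theorem theorem2p7:
  fixes m :: nat and T :: "int mat"
  assumes "m \<ge> 1"
    and "T \<in> carrier_mat m m"
    and "det T \<noteq> 0"
    and "exponential_growth (GmT m T)"
  shows "\<forall>Y. finite_generating_set (GmT m T) Y \<longrightarrow>
    exponentially_negligible (GmT m T) Y (elliptic_subgroup m T)"
proof (intro allI impI)
  fix Y assume Y: "finite_generating_set (GmT m T) Y"
  interpret lattice_hnn m T by unfold_locales (rule assms(2))
  obtain x \<kappa> where "spreading (GmT m T) (tau m T) (gen_t m T) x \<kappa>"
    using spreading_GmT assms(1,4) by auto
  then interpret S: spreading "GmT m T" "tau m T" "gen_t m T" x \<kappa> .
  interpret spreading_fg "GmT m T" "tau m T" "gen_t m T" x \<kappa> Y by unfold_locales (rule Y)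
  have "elliptic_subgroup m T = S.ker"
    by (auto simp: elliptic_subgroup_def kernel_def S.ker_def)
  then show "exponentially_negligible (GmT m T) Y (elliptic_subgroup m T)"
    using ker_exponentially_negligible by simp
qed

end
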